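(* Let $1<p<\infty$ and $0\leq\lambda<n$. Then each of the operators $M$, $M^\sharp$, $H$ and $\mathcal{H}$ is bounded in $V_{0,\infty}^{(\ast)}L^{p,\lambda}(\mathbb{R}^n)$; that is, each maps $V_{0,\infty}^{(\ast)}L^{p,\lambda}(\mathbb{R}^n)$ into itself with $\|Tf\|_{p,\lambda}\leq C\|f\|_{p,\lambda}$ for a constant $C$ independent of $f$, where $T$ is any of these operators.
   Context: For $x\in\mathbb{R}^n$, $r>0$, let $B(x,r)$ be the open ball and $\mathfrak{M}_{p,\lambda}(f;x,r):=\frac{1}{r^\lambda}\int_{B(x,r)}|f(y)|^p\,dy$. The Morrey space $L^{p,\lambda}(\mathbb{R}^n)$ consists of all locally $p$-integrable $f$ on $\mathbb{R}^n$ with $\|f\|_{p,\lambda}:=\sup_{x\in\mathbb{R}^n,\,r>0}\mathfrak{M}_{p,\lambda}(f;x,r)^{1/p}<\infty$. The subspace $V_{0,\infty}^{(\ast)}L^{p,\lambda}(\mathbb{R}^n)$ consists of all $f\in L^{p,\lambda}(\mathbb{R}^n)$ satisfying all three of the properties: - $(V_0)$: $\lim_{r\to0}\sup_{x\in\mathbb{R}^n}\mathfrak{M}_{p,\lambda}(f;x,r)=0$; - $(V_\infty)$: $\lim_{r\to\infty}\sup_{x\in\mathbb{R}^n}\mathfrak{M}_{p,\lambda}(f;x,r)=0$; - $(V^\ast)$: $\lim_{N\to\infty}\sup_{x\in\mathbb{R}^n}\int_{B(x,1)}|f(y)|^p\,\chi_{\mathbb{R}^n\setminus B(0,N)}(y)\,dy=0$.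 Operators: - Hardy-Littlewood maximal operator $Mf(x):=\sup_{t>0}\frac{1}{|B(x,t)|}\int_{B(x,t)}|f(y)|\,dy$. - Sharp maximal function $M^\sharp f(x):=\sup_{t>0}\frac{1}{|B(x,t)|}\int_{B(x,t)}|f(y)-f_{B(x,t)}|\,dy$, where $f_B=\frac{1}{|B|}\int_B f(z)\,dz$. - Hardy operators $Hf(x):=\frac{1}{|x|^n}\int_{|y|<|x|}f(y)\,dy$ and $\mathcal{H}f(x):=\int_{|y|>|x|}\frac{f(y)}{|y|^n}\,dy$. *)

theory Defs
  imports "HOL-Analysis.Analysis"
begin

text \<open>
  Elements of the function spaces are Lebesgue measurable functions rather than classes modulo
  null sets; every notion below is insensitive to changes on a null set, up to null sets.
\<close>

definition locally_p_integrable ::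
  "real \<Rightarrow> ('a::euclidean_space \<Rightarrow> 'b::{banach, second_countable_topology}) \<Rightarrow> bool" where
  "locally_p_integrable p f \<longleftrightarrow>
     f \<in> borel_measurable lebesgue \<and>
     (\<forall>K. compact K \<longrightarrow> set_integrable lebesgue K (\<lambda>y. norm (f y) powr p))"

definition morrey_mod ::
  "real \<Rightarrow> real \<Rightarrow> ('a::euclidean_space \<Rightarrow> 'b::{banach, second_countable_topology}) \<Rightarrow> 'a \<Rightarrow> real \<Rightarrow> real" where
  "morrey_mod p lam f x r =
     (1 / r powr lam) * (LINT y:ball x r|lebesgue. norm (f y) powr p)"

definition morrey_space ::
  "real \<Rightarrow> real \<Rightarrow> ('a::euclidean_space \<Rightarrow> 'b::{banach, second_countable_topology}) set" where
  "morrey_space p lam =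
     {f. locally_p_integrable p f \<and>
         bdd_above ((\<lambda>(x, r). morrey_mod p lam f x r powr (1 / p)) ` (UNIV \<times> {0<..}))}"

text \<open>
  The suprema in the next two definitions are suprema of reals; they are meaningful because for
  members of the Morrey space all the sets involved are bounded.
\<close>

definition morrey_norm ::
  "real \<Rightarrow> real \<Rightarrow> ('a::euclidean_space \<Rightarrow> 'b::{banach, second_countable_topology}) \<Rightarrow> real" where
  "morrey_norm p lam f = (SUP (x, r)\<in>UNIV \<times> {0<..}. morrey_mod p lam f x r powr (1 / p))"

definition vanishing_morrey_space ::
  "real \<Rightarrow> real \<Rightarrow> ('a::euclidean_space \<Rightarrow> 'b::{banach, second_countable_topology}) set" where
  "vanishing_morrey_space p lam =
     {f \<in> morrey_space p lam.
        ((\<lambda>r. SUP x. morrey_mod p lam f x r) \<longlongrightarrow> 0) (at_right 0) \<and>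
        ((\<lambda>r. SUP x. morrey_mod p lam f x r) \<longlongrightarrow> 0) at_top \<and>
        ((\<lambda>N::real. SUP x. LINT y:ball x 1|lebesgue.
             norm (f y) powr p * indicat_real (UNIV - ball 0 N) y) \<longlongrightarrow> 0) at_top}"

text \<open>
  The maximal functions take values in the extended half-line, since the suprema may be infinite.
\<close>

definition maximal_function ::
  "('a::euclidean_space \<Rightarrow> 'b::{banach, second_countable_topology}) \<Rightarrow> 'a \<Rightarrow> ennreal" where
  "maximal_function f x =
     (SUP t\<in>{0<..}. (\<integral>\<^sup>+ y\<in>ball x t. ennreal (norm (f y)) \<partial>lebesgue) / emeasure lebesgue (ball x t))"

definition ball_average ::
  "('a::euclidean_space \<Rightarrow> 'b::{banach, second_countable_topology}) \<Rightarrow> 'a \<Rightarrow> real \<Rightarrow> 'b" where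
  "ball_average f x t =
     (1 / measure lebesgue (ball x t)) *\<^sub>R (LINT z:ball x t|lebesgue. f z)"

definition sharp_maximal_function ::
  "('a::euclidean_space \<Rightarrow> 'b::{banach, second_countable_topology}) \<Rightarrow> 'a \<Rightarrow> ennreal" where
  "sharp_maximal_function f x =
     (SUP t\<in>{0<..}. (\<integral>\<^sup>+ y\<in>ball x t. ennreal (norm (f y - ball_average f x t)) \<partial>lebesgue)
                      / emeasure lebesgue (ball x t))"

definition hardy_op ::
  "('a::euclidean_space \<Rightarrow> 'b::{banach, second_countable_topology}) \<Rightarrow> 'a \<Rightarrow> 'b" where
  "hardy_op f x = (1 / norm x ^ DIM('a)) *\<^sub>R (LINT y:{y. norm y < norm x}|lebesgue. f y)"

definition dual_hardy_op ::
  "('a::euclidean_space \<Rightarrow> 'b::{banach, second_countable_topology}) \<Rightarrow> 'a \<Rightarrow> 'b" where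
  "dual_hardy_op f x = (LINT y:{y. norm x < norm y}|lebesgue. (1 / norm y ^ DIM('a)) *\<^sub>R f y)"

text \<open>
  \<open>D f x\<close> says that the expression defining \<open>T f x\<close> is meaningful (a finite supremum, a convergent
  integral), so that \<open>T f x\<close> is not a default value of a total function.
\<close>

definition bounded_in_vanishing_morrey ::
  "real \<Rightarrow> real \<Rightarrow>
   (('a::euclidean_space \<Rightarrow> 'b::{banach, second_countable_topology}) \<Rightarrow> 'a \<Rightarrow> bool) \<Rightarrow>
   (('a \<Rightarrow> 'b) \<Rightarrow> 'a \<Rightarrow> 'c::{banach, second_countable_topology}) \<Rightarrow> bool" where
  "bounded_in_vanishing_morrey p lam D T \<longleftrightarrow>
     (\<exists>C::real. \<forall>f \<in> vanishing_morrey_space p lam.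
        (AE x in lebesgue. D f x) \<and>
        T f \<in> vanishing_morrey_space p lam \<and>
        morrey_norm p lam (T f) \<le> C * morrey_norm p lam f)"

end

theory Submission
  imports Defs
begin

text \<open>
  For \<open>F = |f|^p\<close> write \<open>I F x r\<close> for the integral of \<open>F\<close> over \<open>ball x r\<close>. If
  \<open>I G x r \<le> C (\<Sum>k. b ^ k I F (c k x) (2 ^ k r))\<close> with \<open>b 2 powr lam < 1\<close> and \<open>c k \<ge> 1\<close>, then the
  Morrey bound and each of the three vanishing properties pass from \<open>F\<close> to \<open>G\<close>, since the series is
  dominated by a geometric one and every single term has the property.

  For the maximal function, the Vitali covering argument is carried out with respect to Lebesgue
  measure restricted to \<open>ball x r\<close>, in the spirit of the Fefferman--Stein weighted inequality. It gives
  the integral of \<open>(M f)^p\<close> over \<open>ball x r\<close> a bound by the integral of \<open>|f|^p\<close> against the weight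
  \<open>(r / (r + |y - x|))^n\<close>, up to a constant, and splitting this weight dyadically is an estimate of
  the above form with \<open>b = 2^(-n)\<close>. The sharp maximal function and the Hardy operator are pointwise
  bounded by multiples of \<open>M f\<close>. The dual Hardy operator is bounded by the sum over \<open>k\<close> of the
  dilates \<open>h (2^k x)\<close> of an average \<open>h\<close> which is itself bounded by a multiple of \<open>M f\<close>.
\<close>

section \<open>Morrey conditions as growth of masses of balls\<close>

text \<open>A pointwise or plain \<open>L^p\<close> bound for the maximal function does not see
  where \<open>f\<close> lives, whereas vanishing is a statement about each single ball. The weight
  repairs this: a Vitali ball of radius \<open>t\<close> counts only if its fivefold dilate meets
  \<open>ball x r\<close>, and what it covers there has measure at most a multiple of
  \<open>min (5 * t) r ^ n\<close>, so its mass is discounted by its distance from \<open>x\<close>.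
  Near and far parts of \<open>f\<close> are thus treated at once. The shell at distance about
  \<open>2 ^ k * r\<close> has weight about \<open>2 ^ (- k * n)\<close> while its mass grows like
  \<open>2 powr (k * lam)\<close>; the hypothesis \<open>lam < n\<close> is the convergence of this
  series.

  The dual Hardy operator has no pointwise bound by \<open>M f\<close>: on the indicator of a large
  ball it is unbounded near the origin. Dilation helps instead, since the mass of the
  \<open>p\<close>-th power of \<open>h (2 ^ k y)\<close> over \<open>ball x r\<close> is
  \<open>2 ^ (- k * n)\<close> times a mass over a ball of radius \<open>2 ^ k * r\<close> around
  \<open>2 ^ k x\<close>. Half of the resulting decay pays for taking the \<open>p\<close>-th power
  of an infinite sum, the other half makes the series of masses converge. The moved centres are why
  factors \<open>c k \<ge> 1\<close> are allowed.\<close>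

definition ball_mass :: "('a::euclidean_space \<Rightarrow> ennreal) \<Rightarrow> 'a \<Rightarrow> real \<Rightarrow> ennreal" where
  "ball_mass F x r = (\<integral>\<^sup>+ y\<in>ball x r. F y \<partial>lebesgue)"

definition mass_bound :: "real \<Rightarrow> real \<Rightarrow> ('a::euclidean_space \<Rightarrow> ennreal) \<Rightarrow> bool" where
  "mass_bound lam K F \<longleftrightarrow> (\<forall>x. \<forall>r>0. ball_mass F x r \<le> ennreal (K * r powr lam))"

text \<open>Quantifying over \<open>x\<close> avoids real suprema and their boundedness conditions.
  The last clause replaces truncation outside \<open>ball 0 N\<close> by unit balls with far
  centres; the two differ only by a shift of \<open>N\<close> by 1.\<close>

definition vanishing_mass :: "real \<Rightarrow> ('a::euclidean_space \<Rightarrow> ennreal) \<Rightarrow> bool" where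
  "vanishing_mass lam F \<longleftrightarrow>
     (\<forall>e>0. \<forall>\<^sub>F r in at_right 0. \<forall>x. ball_mass F x r \<le> ennreal (e * r powr lam)) \<and>
     (\<forall>e>0. \<forall>\<^sub>F r in at_top. \<forall>x. ball_mass F x r \<le> ennreal (e * r powr lam)) \<and>
     (\<forall>e>0. \<forall>\<^sub>F N in at_top. \<forall>x. N \<le> norm x \<longrightarrow> ball_mass F x 1 \<le> ennreal e)"

lemma ball_lebesgue_measurable [measurable]: "ball x r \<in> sets lebesgue"
  by simp

text \<open>A finite cover of \<open>cball 0 R\<close> by unit balls, translated by
  \<open>x\<close>, covers \<open>ball x R\<close> and moves the centres by a bounded amount only.
  Larger radii are needed because the dominating series for a unit ball involves the radii
  \<open>2 ^ k\<close>.\<close>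

lemma vanishing_mass_far:
  fixes F :: "'a::euclidean_space \<Rightarrow> ennreal"
  assumes [measurable]: "F \<in> borel_measurable lebesgue" and "vanishing_mass lam F" and e: "0 < e"
  shows "\<forall>\<^sub>F N in at_top. \<forall>x. N \<le> norm x \<longrightarrow> ball_mass F x R \<le> ennreal e"
proof -
  have "compact (cball (0::'a) R)" by simp
  then obtain S where S: "finite S" "cball (0::'a) R \<subseteq> (\<Union>s\<in>S. ball s 1)"
    unfolding compact_eq_totally_bounded by (metis zero_less_one)
  obtain D where D: "\<And>s. s \<in> S \<Longrightarrow> norm s \<le> D"
    using finite_imp_bounded[OF S(1)] unfolding bounded_iff by blast
  \<comment> \<open>The \<open>+ 1\<close> keeps \<open>e'\<close> positive if \<open>S\<close> is
    empty, which is possible for \<open>R < 0\<close>.\<close>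
  define e' where "e' = e / (card S + 1)"
  have e': "0 < e'" using e by (simp add: e'_def)
  have "\<forall>\<^sub>F N in at_top. \<forall>x. N \<le> norm x \<longrightarrow> ball_mass F x 1 \<le> ennreal e'"
    using assms(2) e' by (simp add: vanishing_mass_def)
  then obtain N0 where N0: "\<And>N x. N0 \<le> N \<Longrightarrow> N \<le> norm x \<Longrightarrow> ball_mass F x 1 \<le> ennreal e'"
    unfolding eventually_at_top_linorder by blast
  have "ball_mass F x R \<le> ennreal e" if x: "N0 + D \<le> norm x" for x
  proof -
    have cover: "indicator (ball x R) y \<le> (\<Sum>s\<in>S. indicator (ball (x + s) 1) y :: ennreal)" for y
    proof (cases "y \<in> ball x R")
      case True
      then have "y - x \<in> cball 0 R" by (simp add: dist_norm norm_minus_commute)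
      then obtain s where s: "s \<in> S" "y - x \<in> ball s 1" using S(2) by blast
      then have "y \<in> ball (x + s) 1" by (simp add: dist_norm algebra_simps)
      then have "1 \<le> (indicator (ball (x + s) 1) y :: ennreal)" by simp
      also have "\<dots> \<le> (\<Sum>s\<in>S. indicator (ball (x + s) 1) y)"
        using s(1) S(1) by (intro member_le_sum) auto
      finally show ?thesis using True by simp
    qed simp
    have "ball_mass F x R \<le> (\<integral>\<^sup>+ y. (\<Sum>s\<in>S. F y * indicator (ball (x + s) 1) y) \<partial>lebesgue)"
      unfolding ball_mass_def using cover
      by (intro nn_integral_mono) (auto simp flip: sum_distrib_left intro!: mult_left_mono)
    also have "\<dots> = (\<Sum>s\<in>S. ball_mass F (x + s) 1)"
      unfolding ball_mass_def by (intro nn_integral_sum) auto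
    also have "\<dots> \<le> (\<Sum>s\<in>S. ennreal e')"
    proof (intro sum_mono N0[of N0])
      fix s assume "s \<in> S"
      have "norm x \<le> norm (x + s) + norm s" by (metis add_diff_cancel norm_triangle_ineq4)
      then show "N0 \<le> norm (x + s)" using x D[OF \<open>s \<in> S\<close>] by simp
    qed auto
    also have "\<dots> = ennreal (card S * e')" using e' by (simp add: ennreal_mult flip: ennreal_of_nat_eq_real_of_nat)
    also have "\<dots> \<le> ennreal e" using e by (intro ennreal_leI) (simp add: e'_def field_simps)
    finally show ?thesis .
  qed
  then show ?thesis unfolding eventually_at_top_linorder
    by (intro exI[of _ "N0 + D"]) (auto intro: order_trans)
qed

text \<open>Terms below \<open>m\<close> use the smallness \<open>e\<close>, the others the global
  constant \<open>K\<close>. Each doubling of the radius costs \<open>2 powr lam\<close>, so both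
  parts are geometric with ratio \<open>a = b * 2 powr lam\<close>. Taking \<open>m = 0\<close> and
  \<open>e = 0\<close> gives the Morrey bound; large \<open>m\<close> gives the vanishing
  conditions.\<close>

lemma ball_mass_le_of_dominated_sum:
  fixes F G :: "'a::euclidean_space \<Rightarrow> ennreal" and c :: "nat \<Rightarrow> real"
  assumes C: "0 \<le> C" and b: "0 \<le> b" "b * 2 powr lam < 1" and K: "0 \<le> K" "mass_bound lam K F"
    and dom: "ball_mass G x r \<le> ennreal C * (\<Sum>k. ennreal (b ^ k) * ball_mass F (c k *\<^sub>R x) (2 ^ k * r))"
    and r: "0 < r" and e: "0 \<le> e"
    and small: "\<And>k. k < m \<Longrightarrow> ball_mass F (c k *\<^sub>R x) (2 ^ k * r) \<le> ennreal (e * (2 ^ k * r) powr lam)"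
  shows "ball_mass G x r \<le> ennreal (C * (e + K * (b * 2 powr lam) ^ m) / (1 - b * 2 powr lam) * r powr lam)"
proof -
  define a where "a = b * 2 powr lam"
  have a: "0 \<le> a" "a < 1" using b by (auto simp: a_def)
  \<comment> \<open>The summand with \<open>e\<close> is kept for all \<open>k\<close>, so that it
    sums to a full geometric series; only the one with \<open>K\<close> is cut off.\<close>
  define t where "t k = r powr lam * (a ^ k * e + (if k < m then 0 else K * a ^ k))" for k
  have t0: "0 \<le> t k" for k using a e K by (simp add: t_def)
  have scale: "b ^ k * (s * (2 ^ k * r) powr lam) = r powr lam * (a ^ k * s)" for s k
    using r by (simp add: a_def powr_mult power_mult_distrib powr_powr flip: powr_realpow)
       (simp add: mult.commute powr_powr flip: powr_realpow)
  have "ennreal (b ^ k) * ball_mass F (c k *\<^sub>R x) (2 ^ k * r) \<le> ennreal (t k)" for k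
  proof (cases "k < m")
    case True
    have "ennreal (b ^ k) * ball_mass F (c k *\<^sub>R x) (2 ^ k * r)
      \<le> ennreal (b ^ k) * ennreal (e * (2 ^ k * r) powr lam)"
      by (intro mult_left_mono small True) auto
    then show ?thesis using b e True by (simp add: scale t_def flip: ennreal_mult)
  next
    case False
    have "ennreal (b ^ k) * ball_mass F (c k *\<^sub>R x) (2 ^ k * r)
      \<le> ennreal (b ^ k) * ennreal (K * (2 ^ k * r) powr lam)"
      using K(2) r unfolding mass_bound_def by (intro mult_left_mono) auto
    also have "\<dots> = ennreal (r powr lam * (a ^ k * K))" using b K by (simp add: scale flip: ennreal_mult)
    also have "\<dots> \<le> ennreal (t k)" using a e K False by (intro ennreal_leI) (simp add: t_def algebra_simps)
    finally show ?thesis .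
  qed
  then have "(\<Sum>k. ennreal (b ^ k) * ball_mass F (c k *\<^sub>R x) (2 ^ k * r)) \<le> (\<Sum>k. ennreal (t k))"
    by (intro suminf_le) auto
  also have "\<dots> = ennreal (r powr lam * (1 / (1 - a) * e + K * a ^ m * (1 / (1 - a))))"
  proof (rule suminf_ennreal_eq[OF t0])
    have "(\<lambda>k. K * a ^ m * a ^ k) sums (K * a ^ m * (1 / (1 - a)))"
      using a by (intro sums_mult geometric_sums) simp
    then have "(\<lambda>k. if k < m then 0 else K * a ^ k) sums (K * a ^ m * (1 / (1 - a)))"
      using sums_iff_shift[of "\<lambda>k. if k < m then 0 else K * a ^ k" m] by (simp add: power_add ac_simps)
    then show "t sums (r powr lam * (1 / (1 - a) * e + K * a ^ m * (1 / (1 - a))))"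
      unfolding t_def using a by (intro sums_mult sums_add sums_mult2 geometric_sums) auto
  qed
  finally have "ball_mass G x r \<le> ennreal C * ennreal (r powr lam * (1 / (1 - a) * e + K * a ^ m * (1 / (1 - a))))"
    using dom by (meson mult_left_mono order_trans zero_le)
  also have "\<dots> = ennreal (C * (e + K * a ^ m) / (1 - a) * r powr lam)"
    using C by (simp add: algebra_simps add_divide_distrib flip: ennreal_mult')
  finally show ?thesis by (simp add: a_def)
qed

lemma dominated_sum_mass_bound:
  fixes F G :: "'a::euclidean_space \<Rightarrow> ennreal" and c :: "nat \<Rightarrow> real"
  assumes "0 \<le> C" and "0 \<le> b" "b * 2 powr lam < 1" and "0 \<le> K" "mass_bound lam K F"
    and dom: "\<And>x r. 0 < r \<Longrightarrow>
      ball_mass G x r \<le> ennreal C * (\<Sum>k. ennreal (b ^ k) * ball_mass F (c k *\<^sub>R x) (2 ^ k * r))"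
  shows "mass_bound lam (C / (1 - b * 2 powr lam) * K) G"
  unfolding mass_bound_def
  using ball_mass_le_of_dominated_sum[OF assms(1-5) dom, of _ 0 0] by simp

text \<open>Once \<open>m\<close> makes the tail \<open>K * a ^ m\<close> small, smallness of
  \<open>G\<close> on one ball follows from finitely many conditions on \<open>F\<close>, and
  finitely many eventual properties hold simultaneously.\<close>

lemma dominated_sum_vanishing_mass:
  fixes F G :: "'a::euclidean_space \<Rightarrow> ennreal" and c :: "nat \<Rightarrow> real"
  assumes F: "F \<in> borel_measurable lebesgue" and lam: "0 \<le> lam"
    and C: "0 \<le> C" and b: "0 \<le> b" "b * 2 powr lam < 1" and K: "0 \<le> K" "mass_bound lam K F"
    and dom: "\<And>x r. 0 < r \<Longrightarrow>
      ball_mass G x r \<le> ennreal C * (\<Sum>k. ennreal (b ^ k) * ball_mass F (c k *\<^sub>R x) (2 ^ k * r))"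
    and c: "\<And>k. 1 \<le> c k" and van: "vanishing_mass lam F"
  shows "vanishing_mass lam G"
proof -
  define a where "a = b * 2 powr lam"
  have a: "0 \<le> a" "a < 1" using b by (auto simp: a_def)
  have small: "\<exists>e'>0. \<exists>m. \<forall>x. \<forall>r>0. (\<forall>k<m. ball_mass F (c k *\<^sub>R x) (2 ^ k * r) \<le> ennreal (e' * (2 ^ k * r) powr lam))
      \<longrightarrow> ball_mass G x r \<le> ennreal (e * r powr lam)" if e: "0 < e" for e
  proof -
    \<comment> \<open>The head and the tail of the series each receive at most \<open>e'\<close>,
      hence the 2; \<open>C + 1\<close> covers the case \<open>C = 0\<close>.\<close>
    define e' where "e' = e * (1 - a) / (2 * (C + 1))"
    have e': "0 < e'" using e a C by (simp add: e'_def)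
    have "(\<lambda>m. K * a ^ m) \<longlonglongrightarrow> K * 0" using a by (intro tendsto_intros LIMSEQ_power_zero) auto
    then have "\<forall>\<^sub>F m in sequentially. K * a ^ m < e'" using e' by (intro order_tendstoD(2)) auto
    then obtain m where m: "K * a ^ m < e'" using eventually_happens by force
    have "C * (e' + K * a ^ m) / (1 - a) \<le> C * (2 * e') / (1 - a)"
      using m a C by (intro divide_right_mono mult_left_mono) auto
    also have "\<dots> = e * (C / (C + 1))" using a C by (simp add: e'_def divide_simps)
    also have "\<dots> \<le> e * 1" using e C by (intro mult_left_mono) auto
    finally have le: "C * (e' + K * a ^ m) / (1 - a) \<le> e" by simp
    show ?thesis
    proof (intro exI[of _ e'] conjI e' exI[of _ m] allI impI)
      fix x r assume r: "0 < (r::real)"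
        and *: "\<forall>k<m. ball_mass F (c k *\<^sub>R x) (2 ^ k * r) \<le> ennreal (e' * (2 ^ k * r) powr lam)"
      have "ball_mass G x r \<le> ennreal (C * (e' + K * a ^ m) / (1 - a) * r powr lam)"
        unfolding a_def using * e'
        by (intro ball_mass_le_of_dominated_sum[where F=F and c=c] C b K dom r) auto
      also have "\<dots> \<le> ennreal (e * r powr lam)" using le by (intro ennreal_leI mult_right_mono) auto
      finally show "ball_mass G x r \<le> ennreal (e * r powr lam)" .
    qed
  qed
  \<comment> \<open>Works for any filter on positive radii that is preserved by multiplication with
    \<open>2 ^ k\<close>, hence both for \<open>at_right 0\<close> and for
    \<open>at_top\<close>.\<close>
  have scaled: "\<forall>e>0. \<forall>\<^sub>F r in X. \<forall>x. ball_mass G x r \<le> ennreal (e * r powr lam)"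
    if X: "\<forall>e>0. \<forall>\<^sub>F r in X. \<forall>x. ball_mass F x r \<le> ennreal (e * r powr lam)"
      and pos: "\<forall>\<^sub>F r in X. 0 < r" and lim: "\<And>k::nat. filterlim (\<lambda>r. 2 ^ k * r) X X" for X
  proof (intro allI impI)
    fix e :: real assume "0 < e"
    from small[OF this] obtain e' m where e': "e' > 0"
      and *: "\<And>x r. 0 < r \<Longrightarrow> (\<forall>k<m. ball_mass F (c k *\<^sub>R x) (2 ^ k * r) \<le> ennreal (e' * (2 ^ k * r) powr lam))
      \<Longrightarrow> ball_mass G x r \<le> ennreal (e * r powr lam)" by blast
    have "\<forall>\<^sub>F r in X. \<forall>x. ball_mass F x (2 ^ k * r) \<le> ennreal (e' * (2 ^ k * r) powr lam)" for k
      using eventually_compose_filterlim[OF _ lim] X e' by auto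
    then have "\<forall>\<^sub>F r in X. \<forall>k\<in>{..<m}. \<forall>x. ball_mass F x (2 ^ k * r) \<le> ennreal (e' * (2 ^ k * r) powr lam)"
      by (intro eventually_ball_finite) auto
    with pos show "\<forall>\<^sub>F r in X. \<forall>x. ball_mass G x r \<le> ennreal (e * r powr lam)"
      by eventually_elim (auto intro!: *)
  qed
  show ?thesis unfolding vanishing_mass_def
  proof (intro conjI scaled)
    show "\<forall>e>0. \<forall>\<^sub>F r in at_right 0. \<forall>x. ball_mass F x r \<le> ennreal (e * r powr lam)"
      "\<forall>e>0. \<forall>\<^sub>F r in at_top. \<forall>x. ball_mass F x r \<le> ennreal (e * r powr lam)"
      using van by (auto simp: vanishing_mass_def)
    show "\<forall>\<^sub>F r::real in at_right 0. 0 < r" by (simp add: eventually_at_right_less)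
    show "filterlim ((*) (2 ^ k)) at_top (at_top :: real filter)" for k
      by (intro filterlim_tendsto_pos_mult_at_top[OF tendsto_const] filterlim_ident) auto
    show "filterlim ((*) (2 ^ k)) (at_right 0) (at_right (0::real))" for k
    proof -
      have "(((*) (2 ^ k)) \<longlongrightarrow> 2 ^ k * 0) (at_right (0::real))" by (intro tendsto_intros)
      then show ?thesis by (auto simp: filterlim_at eventually_at_right_less intro!: eventually_at_rightI[of 0 1])
    qed
    show "\<forall>e>0. \<forall>\<^sub>F N in at_top. \<forall>x. N \<le> norm x \<longrightarrow> ball_mass G x 1 \<le> ennreal e"
    proof (intro allI impI)
      fix e :: real assume "0 < e"
      from small[OF this] obtain e' m where e': "e' > 0"
        and *: "\<And>x r. 0 < r \<Longrightarrow> (\<forall>k<m. ball_mass F (c k *\<^sub>R x) (2 ^ k * r) \<le> ennreal (e' * (2 ^ k * r) powr lam))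
          \<Longrightarrow> ball_mass G x r \<le> ennreal (e * r powr lam)" by blast
      have "\<forall>\<^sub>F N in at_top. \<forall>k\<in>{..<m}. \<forall>x. N \<le> norm x \<longrightarrow> ball_mass F x (2 ^ k) \<le> ennreal e'"
        by (intro eventually_ball_finite ballI vanishing_mass_far[OF F van] e') auto
      then show "\<forall>\<^sub>F N in at_top. \<forall>x. N \<le> norm x \<longrightarrow> ball_mass G x 1 \<le> ennreal e"
      proof eventually_elim
        case (elim N)
        show ?case
        proof (intro allI impI)
          fix x :: 'a assume x: "N \<le> norm x"
          have "ball_mass F (c k *\<^sub>R x) (2 ^ k * 1) \<le> ennreal (e' * (2 ^ k * 1) powr lam)" if "k < m" for k
          proof -
            \<comment> \<open>Since \<open>1 \<le> c k\<close>, the moved centre is still at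
              distance at least \<open>N\<close> from the origin. Since \<open>0 \<le> lam\<close>,
              the bound \<open>e'\<close> may then be relaxed to the scaled one.\<close>
            have "1 * norm x \<le> \<bar>c k\<bar> * norm x" using c[of k] by (intro mult_right_mono) auto
            then have "ball_mass F (c k *\<^sub>R x) (2 ^ k) \<le> ennreal e'" using elim that x by auto
            also have "\<dots> \<le> ennreal (e' * (2 ^ k) powr lam)"
              using e' lam by (intro ennreal_leI) (simp add: ge_one_powr_ge_zero)
            finally show ?thesis by simp
          qed
          then show "ball_mass G x 1 \<le> ennreal e" using *[of 1 x] by simp
        qed
      qed
    qed
  qed (auto simp: eventually_gt_at_top)
qed

section \<open>Translation between Morrey moduli and masses of balls\<close>

text \<open>Also correct for a divergent integral: the Bochner integral then has the default value
  0, and so has \<open>enn2real\<close> at infinity.\<close>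

lemma set_lebesgue_integral_ball_eq_mass:
  fixes f :: "'a::euclidean_space \<Rightarrow> 'b::{banach, second_countable_topology}"
  assumes [measurable]: "f \<in> borel_measurable lebesgue"
  shows "(LINT y:ball x r|lebesgue. norm (f y) powr p)
    = enn2real (ball_mass (\<lambda>y. ennreal (norm (f y) powr p)) x r)"
proof -
  have "(\<integral>\<^sup>+ y. ennreal (indicat_real (ball x r) y *\<^sub>R norm (f y) powr p) \<partial>lebesgue)
    = ball_mass (\<lambda>y. ennreal (norm (f y) powr p)) x r"
    unfolding ball_mass_def by (intro nn_integral_cong) (auto simp: indicator_def)
  moreover have "(\<lambda>y. indicat_real (ball x r) y *\<^sub>R norm (f y) powr p) \<in> borel_measurable lebesgue"
    by measurable
  ultimately show ?thesis
    unfolding set_lebesgue_integral_def by (subst integral_eq_nn_integral) auto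
qed

lemma set_integrable_ball_iff_mass:
  fixes f :: "'a::euclidean_space \<Rightarrow> 'b::{banach, second_countable_topology}"
  assumes [measurable]: "f \<in> borel_measurable lebesgue"
  shows "set_integrable lebesgue (ball x r) (\<lambda>y. norm (f y) powr p)
    \<longleftrightarrow> ball_mass (\<lambda>y. ennreal (norm (f y) powr p)) x r < \<infinity>"
proof -
  have "(\<integral>\<^sup>+ y. ennreal (norm (indicat_real (ball x r) y *\<^sub>R norm (f y) powr p)) \<partial>lebesgue)
    = (\<integral>\<^sup>+ y\<in>ball x r. ennreal (norm (f y) powr p) \<partial>lebesgue)"
    by (intro nn_integral_cong) (auto simp: indicator_def)
  then show ?thesis
    unfolding set_integrable_def integrable_iff_bounded ball_mass_def by simp
qed

lemma ball_mass_eq_set_lebesgue_integral: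
  fixes f :: "'a::euclidean_space \<Rightarrow> 'b::{banach, second_countable_topology}"
  assumes "locally_p_integrable p f"
  shows "ball_mass (\<lambda>y. ennreal (norm (f y) powr p)) x r
    = ennreal (LINT y:ball x r|lebesgue. norm (f y) powr p)"
proof -
  have m: "f \<in> borel_measurable lebesgue" using assms by (simp add: locally_p_integrable_def)
  have "set_integrable lebesgue (cball x r) (\<lambda>y. norm (f y) powr p)"
    using assms by (simp add: locally_p_integrable_def)
  then have "set_integrable lebesgue (ball x r) (\<lambda>y. norm (f y) powr p)"
    by (rule set_integrable_subset) auto
  then show ?thesis
    by (simp add: set_integrable_ball_iff_mass[OF m] set_lebesgue_integral_ball_eq_mass[OF m])
qed

text \<open>Local integrability excludes the default value 0 of a divergent integral, for which the
  right-hand side would hold although the mass is infinite.\<close>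

lemma ball_mass_le_iff_morrey_mod:
  fixes f :: "'a::euclidean_space \<Rightarrow> 'b::{banach, second_countable_topology}"
  assumes "locally_p_integrable p f" and "0 < r" and "0 \<le> A"
  shows "ball_mass (\<lambda>y. ennreal (norm (f y) powr p)) x r \<le> ennreal (A * r powr lam)
    \<longleftrightarrow> morrey_mod p lam f x r \<le> A"
  using assms unfolding ball_mass_eq_set_lebesgue_integral[OF assms(1)] morrey_mod_def
  by (simp add: field_simps ennreal_le_iff2 mult_le_0_iff)
     (auto simp: zero_le_mult_iff intro: order_trans[OF _ mult_nonneg_nonneg])

lemma morrey_mod_nonneg: "0 \<le> morrey_mod p lam f x r"
  unfolding morrey_mod_def set_lebesgue_integral_def
  by (intro mult_nonneg_nonneg integral_nonneg_AE) auto

lemma locally_p_integrable_if_mass_bound: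
  fixes f :: "'a::euclidean_space \<Rightarrow> 'b::{banach, second_countable_topology}"
  assumes m: "f \<in> borel_measurable lebesgue"
    and K: "mass_bound lam K (\<lambda>y. ennreal (norm (f y) powr p))"
  shows "locally_p_integrable p f"
  unfolding locally_p_integrable_def
proof (intro conjI m allI impI)
  fix S :: "'a set" assume S: "compact S"
  then obtain r where r: "0 < r" "S \<subseteq> ball 0 r"
    by (metis bounded_subset_ballD compact_imp_bounded)
  have "set_integrable lebesgue (ball 0 r) (\<lambda>y. norm (f y) powr p)"
    using K r(1) unfolding set_integrable_ball_iff_mass[OF m] mass_bound_def
    by (metis ennreal_less_top infinity_ennreal_def order_le_less_trans)
  then show "set_integrable lebesgue S (\<lambda>y. norm (f y) powr p)"
    using fmeasurableD[OF lmeasurable_compact[OF S]] r(2) by (rule set_integrable_subset)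
qed

lemma bdd_above_morrey_iff:
  assumes "0 < p"
  shows "bdd_above ((\<lambda>(x, r). morrey_mod p lam f x r powr (1 / p)) ` (UNIV \<times> {0<..}))
    \<longleftrightarrow> (\<exists>K\<ge>0. \<forall>x. \<forall>r>0. morrey_mod p lam f x r \<le> K)"
proof
  assume "bdd_above ((\<lambda>(x, r). morrey_mod p lam f x r powr (1 / p)) ` (UNIV \<times> {0<..}))"
  then obtain A where A: "\<And>x r. 0 < r \<Longrightarrow> morrey_mod p lam f x r powr (1 / p) \<le> A"
    unfolding bdd_above_def by fastforce
  have "morrey_mod p lam f x r \<le> A powr p" if "0 < r" for x r
  proof -
    have "(morrey_mod p lam f x r powr (1 / p)) powr p \<le> A powr p"
      using A[OF that] assms by (intro powr_mono2) auto
    then show ?thesis using assms by (simp add: powr_powr morrey_mod_nonneg)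
  qed
  then show "\<exists>K\<ge>0. \<forall>x. \<forall>r>0. morrey_mod p lam f x r \<le> K" by (intro exI[of _ "A powr p"]) auto
next
  assume "\<exists>K\<ge>0. \<forall>x. \<forall>r>0. morrey_mod p lam f x r \<le> K"
  then obtain K where "\<And>x r. 0 < r \<Longrightarrow> morrey_mod p lam f x r \<le> K" by blast
  then have "\<And>x r. 0 < r \<Longrightarrow> morrey_mod p lam f x r powr (1 / p) \<le> K powr (1 / p)"
    using assms by (intro powr_mono2) (auto simp: morrey_mod_nonneg)
  then show "bdd_above ((\<lambda>(x, r). morrey_mod p lam f x r powr (1 / p)) ` (UNIV \<times> {0<..}))"
    unfolding bdd_above_def by (intro exI[of _ "K powr (1 / p)"]) auto
qed

text \<open>A compact set lies in a ball, so a mass bound already contains local integrability;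
  membership reduces to measurability and one growth estimate.\<close>

lemma morrey_space_iff:
  fixes f :: "'a::euclidean_space \<Rightarrow> 'b::{banach, second_countable_topology}"
  assumes "0 < p"
  shows "f \<in> morrey_space p lam \<longleftrightarrow> f \<in> borel_measurable lebesgue \<and>
    (\<exists>K\<ge>0. mass_bound lam K (\<lambda>y. ennreal (norm (f y) powr p)))"
proof -
  have "f \<in> morrey_space p lam \<longleftrightarrow> locally_p_integrable p f \<and>
    (\<exists>K\<ge>0. mass_bound lam K (\<lambda>y. ennreal (norm (f y) powr p)))"
    using ball_mass_le_iff_morrey_mod[of p f]
    unfolding morrey_space_def bdd_above_morrey_iff[OF assms] mass_bound_def by blast
  moreover have "locally_p_integrable p f \<Longrightarrow> f \<in> borel_measurable lebesgue"
    by (simp add: locally_p_integrable_def)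
  ultimately show ?thesis using locally_p_integrable_if_mass_bound by blast
qed

lemma morrey_norm_le:
  fixes f :: "'a::euclidean_space \<Rightarrow> 'b::{banach, second_countable_topology}"
  assumes p: "0 < p" and m: "f \<in> borel_measurable lebesgue"
    and K: "0 \<le> K" "mass_bound lam K (\<lambda>y. ennreal (norm (f y) powr p))"
  shows "morrey_norm p lam f \<le> K powr (1 / p)"
  unfolding morrey_norm_def
proof (rule cSUP_least)
  fix z :: "'a \<times> real" assume z: "z \<in> UNIV \<times> {0<..}"
  have "morrey_mod p lam f (fst z) (snd z) \<le> K"
    using ball_mass_le_iff_morrey_mod[OF locally_p_integrable_if_mass_bound[OF m K(2)]] K z
    unfolding mass_bound_def by auto
  then show "(case z of (x, r) \<Rightarrow> morrey_mod p lam f x r powr (1 / p)) \<le> K powr (1 / p)"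
    using p by (auto simp: split_beta morrey_mod_nonneg intro: powr_mono2)
qed auto

text \<open>The supremum is attained as a bound on every ball. Together with
  \<open>morrey_norm_le\<close> this identifies the \<open>p\<close>-th power of the norm as the
  least nonnegative constant in \<open>mass_bound\<close>.\<close>

lemma mass_bound_morrey_norm:
  fixes f :: "'a::euclidean_space \<Rightarrow> 'b::{banach, second_countable_topology}"
  assumes p: "0 < p" and f: "f \<in> morrey_space p lam"
  shows "0 \<le> morrey_norm p lam f"
    and "mass_bound lam (morrey_norm p lam f powr p) (\<lambda>y. ennreal (norm (f y) powr p))"
proof -
  have le: "morrey_mod p lam f x r powr (1 / p) \<le> morrey_norm p lam f" if "0 < r" for x r
    unfolding morrey_norm_def
    using f that by (intro cSUP_upper2[where x="(x, r)"]) (auto simp: morrey_space_def)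
  then show nonneg: "0 \<le> morrey_norm p lam f" by (meson order_trans powr_ge_zero zero_less_one)
  have "morrey_mod p lam f x r \<le> morrey_norm p lam f powr p" if "0 < r" for x r
  proof -
    have "(morrey_mod p lam f x r powr (1 / p)) powr p \<le> morrey_norm p lam f powr p"
      using le[OF that] p by (intro powr_mono2) auto
    then show ?thesis using p by (simp add: powr_powr morrey_mod_nonneg)
  qed
  then show "mass_bound lam (morrey_norm p lam f powr p) (\<lambda>y. ennreal (norm (f y) powr p))"
    using f ball_mass_le_iff_morrey_mod[of p f] unfolding mass_bound_def morrey_space_def by auto
qed

text \<open>Eventual boundedness rules out the unspecified real supremum of an unbounded set;
  nonnegativity supplies the lower half of the limit.\<close>

lemma tendsto_SUP_zero_iff:
  fixes g :: "'x \<Rightarrow> 'y \<Rightarrow> real"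
  assumes "\<forall>\<^sub>F r in X. bdd_above (range (g r)) \<and> (\<forall>x. 0 \<le> g r x)"
  shows "((\<lambda>r. SUP x. g r x) \<longlongrightarrow> 0) X \<longleftrightarrow> (\<forall>e>0. \<forall>\<^sub>F r in X. \<forall>x. g r x \<le> e)"
proof (intro iffI allI impI)
  fix e :: real assume "((\<lambda>r. SUP x. g r x) \<longlongrightarrow> 0) X" "0 < e"
  then have "\<forall>\<^sub>F r in X. (SUP x. g r x) < e" by (intro order_tendstoD(2))
  with assms show "\<forall>\<^sub>F r in X. \<forall>x. g r x \<le> e"
  proof eventually_elim
    case (elim r)
    show ?case
    proof
      fix x
      have "g r x \<le> (SUP x. g r x)" using elim by (intro cSUP_upper) auto
      then show "g r x \<le> e" using elim by simp
    qed
  qed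
next
  assume small: "\<forall>e>0. \<forall>\<^sub>F r in X. \<forall>x. g r x \<le> e"
  show "((\<lambda>r. SUP x. g r x) \<longlongrightarrow> 0) X"
  proof (rule tendstoI)
    fix e :: real assume "0 < e"
    then have "\<forall>\<^sub>F r in X. \<forall>x. g r x \<le> e / 2" using small half_gt_zero by blast
    with assms show "\<forall>\<^sub>F r in X. dist (SUP x. g r x) 0 < e"
    proof eventually_elim
      case (elim r)
      have "(SUP x. g r x) \<le> e / 2" using elim by (intro cSUP_least) auto
      moreover have "0 \<le> (SUP x. g r x)"
        using elim by (intro cSUP_upper2[where x=undefined]) auto
      ultimately show ?case using \<open>0 < e\<close> by simp
    qed
  qed
qed

text \<open>The unit ball around \<open>x\<close> misses \<open>ball 0 N\<close> if
  \<open>N + 1 \<le> norm x\<close> and lies inside it if \<open>norm x + 1 \<le> N\<close>. In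
  between only monotonicity remains, which is where the shifts by 1 in comparing the far-field
  conditions come from.\<close>

lemma set_lebesgue_integral_ball_outside:
  fixes f :: "'a::euclidean_space \<Rightarrow> 'b::{banach, second_countable_topology}"
  assumes f: "locally_p_integrable p f"
  defines "I \<equiv> \<lambda>N x. LINT y:ball x 1|lebesgue. norm (f y) powr p * indicat_real (UNIV - ball 0 N) y"
  shows "0 \<le> I N x" and "I N x \<le> (LINT y:ball x 1|lebesgue. norm (f y) powr p)"
    and "N + 1 \<le> norm x \<Longrightarrow> I N x = (LINT y:ball x 1|lebesgue. norm (f y) powr p)"
    and "norm x + 1 \<le> N \<Longrightarrow> I N x = 0"
proof -
  have [measurable]: "f \<in> borel_measurable lebesgue" using f by (simp add: locally_p_integrable_def)
  have int: "integrable lebesgue (\<lambda>y. indicat_real (ball x 1) y *\<^sub>R norm (f y) powr p)"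
    using ball_mass_eq_set_lebesgue_integral[OF f, of x 1] set_integrable_ball_iff_mass[of f x 1 p]
    by (simp add: set_integrable_def)
  show "0 \<le> I N x" unfolding I_def set_lebesgue_integral_def by (intro integral_nonneg_AE) auto
  show "I N x \<le> (LINT y:ball x 1|lebesgue. norm (f y) powr p)"
    unfolding I_def set_lebesgue_integral_def
  proof (intro integral_mono Bochner_Integration.integrable_bound[OF int] int AE_I2)
    show "(\<lambda>y. indicat_real (ball x 1) y *\<^sub>R (norm (f y) powr p * indicat_real (UNIV - ball 0 N) y))
      \<in> borel_measurable lebesgue"
      "(\<lambda>y. indicat_real (ball x 1) y *\<^sub>R norm (f y) powr p) \<in> borel_measurable lebesgue"
      by measurable
  qed (auto simp: indicator_def)
  show "I N x = (LINT y:ball x 1|lebesgue. norm (f y) powr p)" if N: "N + 1 \<le> norm x"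
  proof -
    have "norm x < norm y + 1" if "dist x y < 1" for y
      using that norm_triangle_ineq2[of x y] by (simp add: dist_norm)
    then show ?thesis unfolding I_def set_lebesgue_integral_def
      using N by (intro Bochner_Integration.integral_cong) (force simp: indicator_def)+
  qed
  show "I N x = 0" if N: "norm x + 1 \<le> N"
  proof -
    have "norm y < norm x + 1" if "dist x y < 1" for y
      using that norm_triangle_ineq2[of y x] by (simp add: dist_norm norm_minus_commute)
    then have "I N x = (\<integral>y. 0 \<partial>(lebesgue :: 'a measure))" unfolding I_def set_lebesgue_integral_def
      using N by (intro Bochner_Integration.integral_cong) (force simp: indicator_def)+
    then show ?thesis by simp
  qed
qed

lemma vanishing_morrey_space_iff:
  fixes f :: "'a::euclidean_space \<Rightarrow> 'b::{banach, second_countable_topology}"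
  assumes p: "0 < p"
  shows "f \<in> vanishing_morrey_space p lam \<longleftrightarrow>
    f \<in> morrey_space p lam \<and> vanishing_mass lam (\<lambda>y. ennreal (norm (f y) powr p))"
proof (cases "f \<in> morrey_space p lam")
  case True
  let ?F = "\<lambda>y. ennreal (norm (f y) powr p)"
  let ?I = "\<lambda>N x. LINT y:ball x 1|lebesgue. norm (f y) powr p * indicat_real (UNIV - ball 0 N) y"
  have f: "locally_p_integrable p f" using True by (simp add: morrey_space_def)
  obtain K where K: "\<And>x r. 0 < r \<Longrightarrow> morrey_mod p lam f x r \<le> K"
    using True bdd_above_morrey_iff[OF p, of lam f] unfolding morrey_space_def by blast
  have mod: "((\<lambda>r. SUP x. morrey_mod p lam f x r) \<longlongrightarrow> 0) X \<longleftrightarrow>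
      (\<forall>e>0. \<forall>\<^sub>F r in X. \<forall>x. ball_mass ?F x r \<le> ennreal (e * r powr lam))"
    if pos: "\<forall>\<^sub>F r in X. 0 < r" for X
  proof -
    have "(\<forall>\<^sub>F r in X. \<forall>x. morrey_mod p lam f x r \<le> e) \<longleftrightarrow>
      (\<forall>\<^sub>F r in X. \<forall>x. ball_mass ?F x r \<le> ennreal (e * r powr lam))" if "0 < e" for e
      by (rule eventually_cong[OF pos]) (use that in \<open>simp add: ball_mass_le_iff_morrey_mod[OF f]\<close>)
    moreover have "\<forall>\<^sub>F r in X. bdd_above (range (\<lambda>x. morrey_mod p lam f x r)) \<and> (\<forall>x. 0 \<le> morrey_mod p lam f x r)"
      using pos by eventually_elim (auto simp: bdd_above_def morrey_mod_nonneg intro: K)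
    ultimately show ?thesis by (simp add: tendsto_SUP_zero_iff)
  qed
  have le_iff: "ball_mass ?F x 1 \<le> ennreal e \<longleftrightarrow> (LINT y:ball x 1|lebesgue. norm (f y) powr p) \<le> e"
    if "0 < e" for x e
    using that by (simp add: ball_mass_eq_set_lebesgue_integral[OF f] ennreal_le_iff)
  have I1: "(LINT y:ball x 1|lebesgue. norm (f y) powr p) \<le> K" for x
    using K[of 1 x] by (simp add: morrey_mod_def)
  have "((\<lambda>N. SUP x. ?I N x) \<longlongrightarrow> 0) at_top \<longleftrightarrow> (\<forall>e>0. \<forall>\<^sub>F N in at_top. \<forall>x. ?I N x \<le> e)"
    using set_lebesgue_integral_ball_outside(1)[OF f]
      order_trans[OF set_lebesgue_integral_ball_outside(2)[OF f] I1]
    by (intro tendsto_SUP_zero_iff always_eventually allI conjI bdd_aboveI[where M=K]) auto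
  also have "\<dots> \<longleftrightarrow> (\<forall>e>0. \<forall>\<^sub>F N in at_top. \<forall>x. N \<le> norm x \<longrightarrow> ball_mass ?F x 1 \<le> ennreal e)"
  proof (intro iffI allI impI)
    fix e :: real assume "\<forall>e>0. \<forall>\<^sub>F N in at_top. \<forall>x. ?I N x \<le> e" "0 < e"
    then obtain N0 where N0: "\<And>x. ?I N0 x \<le> e" unfolding eventually_at_top_linorder by blast
    show "\<forall>\<^sub>F N in at_top. \<forall>x. N \<le> norm x \<longrightarrow> ball_mass ?F x 1 \<le> ennreal e"
      unfolding eventually_at_top_linorder
    proof (intro exI[of _ "N0 + 1"] allI impI)
      fix N and x :: 'a assume "N0 + 1 \<le> N" "N \<le> norm x"
      then show "ball_mass ?F x 1 \<le> ennreal e"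
        using N0[of x] set_lebesgue_integral_ball_outside(3)[OF f, of N0 x] le_iff[OF \<open>0 < e\<close>] by auto
    qed
  next
    fix e :: real
    assume "\<forall>e>0. \<forall>\<^sub>F N in at_top. \<forall>x. N \<le> norm x \<longrightarrow> ball_mass ?F x 1 \<le> ennreal e" and e: "0 < e"
    then obtain N0 where N0: "\<And>x. N0 \<le> norm x \<Longrightarrow> ball_mass ?F x 1 \<le> ennreal e"
      unfolding eventually_at_top_linorder by blast
    show "\<forall>\<^sub>F N in at_top. \<forall>x. ?I N x \<le> e"
      unfolding eventually_at_top_linorder
    proof (intro exI[of _ "N0 + 1"] allI impI)
      fix N x assume N: "N0 + 1 \<le> N"
      show "?I N x \<le> e"
      proof (cases "N0 \<le> norm x")
        case True
        then show ?thesis using N0[OF True] le_iff[OF e] set_lebesgue_integral_ball_outside(2)[OF f, of x N]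
          by auto
      next
        case False
        then show ?thesis using set_lebesgue_integral_ball_outside(4)[OF f, of x N] N e by auto
      qed
    qed
  qed
  finally show ?thesis
    using True mod[of "at_right 0"] mod[of at_top]
    unfolding vanishing_morrey_space_def vanishing_mass_def
    by (simp add: eventually_at_right_less eventually_gt_at_top)
qed (simp add: vanishing_morrey_space_def)

text \<open>The reference operator \<open>S\<close> is the identity for \<open>M\<close>,
  \<open>M^#\<close> and \<open>H\<close>. For the dual Hardy operator it is
  \<open>hardy_average\<close>, whose boundedness is known by then. The operator constant is the
  \<open>p\<close>-th root of the constant of the series times that of \<open>S\<close>.\<close>

lemma bounded_in_vanishing_morrey_dominated:
  fixes S :: "('a::euclidean_space \<Rightarrow> 'b::{banach, second_countable_topology})
      \<Rightarrow> 'a \<Rightarrow> 'd::{banach, second_countable_topology}"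
    and T :: "('a \<Rightarrow> 'b) \<Rightarrow> 'a \<Rightarrow> 'c::{banach, second_countable_topology}" and c :: "nat \<Rightarrow> real"
  assumes p: "0 < p" and lam: "0 \<le> lam" and C: "0 \<le> C" and b: "0 \<le> b" "b * 2 powr lam < 1"
    and c: "\<And>k. 1 \<le> c k"
    and S: "bounded_in_vanishing_morrey p lam E S"
    and D: "\<And>f. f \<in> vanishing_morrey_space p lam \<Longrightarrow> AE x in lebesgue. D f x"
    and meas: "\<And>f. f \<in> vanishing_morrey_space p lam \<Longrightarrow> T f \<in> borel_measurable lebesgue"
    and dom: "\<And>f x r. f \<in> vanishing_morrey_space p lam \<Longrightarrow> 0 < r \<Longrightarrow>
      ball_mass (\<lambda>y. ennreal (norm (T f y) powr p)) x r \<le> ennreal C *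
        (\<Sum>k. ennreal (b ^ k) * ball_mass (\<lambda>y. ennreal (norm (S f y) powr p)) (c k *\<^sub>R x) (2 ^ k * r))"
  shows "bounded_in_vanishing_morrey p lam D T"
proof -
  obtain C' where C': "\<And>f. f \<in> vanishing_morrey_space p lam \<Longrightarrow> S f \<in> vanishing_morrey_space p lam"
    "\<And>f. f \<in> vanishing_morrey_space p lam \<Longrightarrow> morrey_norm p lam (S f) \<le> C' * morrey_norm p lam f"
    using S unfolding bounded_in_vanishing_morrey_def by blast
  let ?A = "C / (1 - b * 2 powr lam)"
  have A: "0 \<le> ?A" using C b by simp
  show ?thesis
    unfolding bounded_in_vanishing_morrey_def
  proof (intro exI[of _ "?A powr (1 / p) * C'"] ballI conjI D)
    fix f :: "'a \<Rightarrow> 'b" assume f: "f \<in> vanishing_morrey_space p lam"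
    let ?F = "\<lambda>y. ennreal (norm (S f y) powr p)" and ?G = "\<lambda>y. ennreal (norm (T f y) powr p)"
    let ?n = "morrey_norm p lam (S f)"
    have SM: "S f \<in> morrey_space p lam" and van: "vanishing_mass lam ?F"
      using C'(1)[OF f] by (auto simp: vanishing_morrey_space_iff[OF p])
    have [measurable]: "S f \<in> borel_measurable lebesgue" using SM by (simp add: morrey_space_iff[OF p])
    note n = mass_bound_morrey_norm[OF p SM]
    have bound: "mass_bound lam (?A * ?n powr p) ?G"
      by (rule dominated_sum_mass_bound[OF C b _ n(2) dom[OF f]]) auto
    moreover have "vanishing_mass lam ?G"
      by (rule dominated_sum_vanishing_mass[OF _ lam C b _ n(2) dom[OF f] c van]) auto
    ultimately show "T f \<in> vanishing_morrey_space p lam"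
      using meas[OF f] mult_nonneg_nonneg[OF A powr_ge_zero[of ?n p]]
      unfolding vanishing_morrey_space_iff[OF p] morrey_space_iff[OF p] by blast
    have "morrey_norm p lam (T f) \<le> (?A * ?n powr p) powr (1 / p)"
      using A by (intro morrey_norm_le[OF p meas[OF f] _ bound] mult_nonneg_nonneg) auto
    also have "\<dots> = ?A powr (1 / p) * ?n" using n(1) p by (subst powr_mult) (simp_all add: powr_powr)
    also have "\<dots> \<le> ?A powr (1 / p) * (C' * morrey_norm p lam f)"
      by (intro mult_left_mono C'(2) f) simp
    finally show "morrey_norm p lam (T f) \<le> ?A powr (1 / p) * C' * morrey_norm p lam f"
      by (simp add: mult.assoc)
  qed
qed

lemma bounded_in_vanishing_morrey_id:
  "bounded_in_vanishing_morrey p lam (\<lambda>_ _. True)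
    (\<lambda>f :: 'a::euclidean_space \<Rightarrow> 'b::{banach, second_countable_topology}. f)"
  unfolding bounded_in_vanishing_morrey_def by (intro exI[of _ 1]) auto

section \<open>The weighted maximal inequality\<close>

lemma sigma_finite_lebesgue: "sigma_finite_measure (lebesgue :: 'a::euclidean_space measure)"
proof
  show "\<exists>A. countable A \<and> A \<subseteq> sets (lebesgue :: 'a measure) \<and> \<Union> A = space lebesgue \<and> (\<forall>a\<in>A. emeasure lebesgue a \<noteq> \<infinity>)"
  proof (intro exI[of _ "range (\<lambda>n::nat. ball (0::'a) (real n))"] conjI)
    show "\<Union> (range (\<lambda>n::nat. ball (0::'a) (real n))) = space lebesgue"
      by (auto intro: reals_Archimedean2)
  qed (use emeasure_lborel_ball_finite in \<open>auto simp: less_top\<close>)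
qed

lemma emeasure_lebesgue_ball:
  fixes x :: "'a::euclidean_space"
  assumes "0 \<le> r"
  shows "emeasure lebesgue (ball x r) = ennreal (r ^ DIM('a) * measure lebesgue (ball (0::'a) 1))"
proof -
  have "emeasure lebesgue (ball x r) = ennreal (measure lebesgue (ball x r))"
    using emeasure_lborel_ball_finite[of x r] by (intro emeasure_eq_ennreal_measure) auto
  then show ?thesis using content_ball_conv_unit_ball[OF assms, of x] by simp
qed

lemma measure_lebesgue_unit_ball_pos: "0 < measure lebesgue (ball (0::'a::euclidean_space) 1)"
  using content_ball_pos[of 1 "0::'a"] by simp

lemma ennreal_less_divide_iff:
  fixes y m :: ennreal
  assumes "0 < v"
  shows "y < m / ennreal v \<longleftrightarrow> y * ennreal v < m"
  using assms
  by (cases y; cases m)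
     (auto simp: divide_ennreal ennreal_top_divide ennreal_less_iff ennreal_top_mult field_simps
       simp flip: ennreal_mult)

section \<open>Semicontinuity of masses and measurability of the maximal function\<close>

lemma ball_mass_eq_emeasure_density:
  assumes "g \<in> borel_measurable lebesgue"
  shows "ball_mass g x t = emeasure (density lebesgue g) (ball x t)"
  using assms unfolding ball_mass_def by (subst emeasure_density) auto

text \<open>The slightly smaller concentric balls exhaust \<open>ball x t\<close>, so one of them
  already has mass above \<open>c\<close>; it stays inside \<open>ball z t\<close> for all
  \<open>z\<close> near \<open>x\<close>.\<close>

lemma open_less_ball_mass:
  assumes g: "g \<in> borel_measurable lebesgue"
  shows "open {x. c < ball_mass g x t}"
proof (subst open_subopen, intro ballI)
  fix x assume "x \<in> {x. c < ball_mass g x t}"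
  then have c: "c < ball_mass g x t" by simp
  define A where "A k = ball x (t - 1 / Suc k)" for k :: nat
  have "(\<Union>k. A k) = ball x t"
  proof (intro equalityI subsetI)
    fix y assume "y \<in> ball x t"
    then obtain k where "1 / Suc k < t - dist x y" using nat_approx_posE[of "t - dist x y"] by auto
    then show "y \<in> (\<Union>k. A k)" by (auto simp: A_def intro!: exI[of _ k])
  next
    fix y assume "y \<in> (\<Union>k. A k)"
    then obtain k where "dist x y < t - 1 / Suc k" by (auto simp: A_def)
    also have "\<dots> < t" by simp
    finally show "y \<in> ball x t" by simp
  qed
  moreover have "incseq A"
    unfolding A_def by (intro monoI subset_ball diff_left_mono divide_left_mono) auto
  moreover have "range A \<subseteq> sets (density lebesgue g)" by (auto simp: A_def)
  ultimately have "(SUP k. emeasure (density lebesgue g) (A k)) = ball_mass g x t"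
    using SUP_emeasure_incseq[of A "density lebesgue g"] by (simp add: ball_mass_eq_emeasure_density[OF g])
  then obtain k where k: "c < emeasure (density lebesgue g) (A k)" using c by (metis less_SUP_iff)
  have "c < ball_mass g z t" if "z \<in> ball x (1 / Suc k)" for z
  proof -
    have "A k \<subseteq> ball z t"
    proof
      fix y assume "y \<in> A k"
      then show "y \<in> ball z t" using that dist_triangle[of z y x] by (simp add: A_def dist_commute)
    qed
    then have "emeasure (density lebesgue g) (A k) \<le> ball_mass g z t"
      unfolding ball_mass_eq_emeasure_density[OF g] by (intro emeasure_mono) auto
    with k show ?thesis by simp
  qed
  then show "\<exists>T. open T \<and> x \<in> T \<and> T \<subseteq> {x. c < ball_mass g x t}"
    by (intro exI[of _ "ball x (1 / Suc k)"]) auto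
qed

text \<open>Stated for extended nonnegative functions, so that it applies to truncations of
  \<open>g\<close> without any finiteness condition.\<close>

definition hl_maximal :: "('a::euclidean_space \<Rightarrow> ennreal) \<Rightarrow> 'a \<Rightarrow> ennreal" where
  "hl_maximal g x = (SUP t\<in>{0<..}. ball_mass g x t / emeasure lebesgue (ball x t))"

lemma maximal_function_eq_hl_maximal:
  "maximal_function f = hl_maximal (\<lambda>y. ennreal (norm (f y)))"
  by (simp add: fun_eq_iff maximal_function_def hl_maximal_def ball_mass_def)

lemma less_hl_maximal_iff:
  "c < hl_maximal g x \<longleftrightarrow> (\<exists>t>0. c * emeasure lebesgue (ball x t) < ball_mass g x t)"
proof -
  have "c < ball_mass g x t / emeasure lebesgue (ball x t) \<longleftrightarrow> c * emeasure lebesgue (ball x t) < ball_mass g x t"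
    if "0 < t" for t
    unfolding emeasure_lebesgue_ball[OF less_imp_le[OF that]]
    using that measure_lebesgue_unit_ball_pos[where 'a='a] by (intro ennreal_less_divide_iff) simp
  then show ?thesis unfolding hl_maximal_def less_SUP_iff by auto
qed

text \<open>The set \<open>T\<close> of admissible radii is everything for the measurability of
  \<open>hl_maximal\<close>, and \<open>{..R}\<close> for the covering argument, where Vitali's
  lemma wants bounded radii.\<close>

lemma open_less_hl_maximal_radius:
  fixes g :: "'a::euclidean_space \<Rightarrow> ennreal"
  assumes "g \<in> borel_measurable lebesgue"
  shows "open {x. \<exists>t\<in>T \<inter> {0<..}. c * emeasure lebesgue (ball x t) < ball_mass g x t}"
proof -
  have "{x. \<exists>t\<in>T \<inter> {0<..}. c * emeasure lebesgue (ball x t) < ball_mass g x t}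
    = (\<Union>t\<in>T \<inter> {0<..}. {x. c * ennreal (t ^ DIM('a) * measure lebesgue (ball (0::'a) 1)) < ball_mass g x t})"
    unfolding UN_simps using emeasure_lebesgue_ball[where 'a='a, OF less_imp_le] by fastforce
  then show ?thesis using open_less_ball_mass[OF assms] by auto
qed

lemma borel_measurable_hl_maximal:
  assumes "g \<in> borel_measurable lebesgue"
  shows "hl_maximal g \<in> borel_measurable borel"
proof (rule borel_measurableI_greater)
  fix c show "{x \<in> space borel. c < hl_maximal g x} \<in> sets borel"
    using open_less_hl_maximal_radius[OF assms, of UNIV c] by (simp add: less_hl_maximal_iff Bex_def)
qed

section \<open>Vitali covering and the weighted weak-type inequality\<close>

text \<open>Here \<open>d\<close> is the distance from the centre \<open>x0\<close> to a point of a
  Vitali ball of radius \<open>t\<close> whose fivefold dilate meets \<open>ball x0 r\<close>.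
  Estimating the minimum by \<open>5 * t\<close> against \<open>2 * r\<close> and by
  \<open>r\<close> against \<open>6 * t\<close> gives \<open>16 = 10 + 6\<close>.\<close>

lemma vitali_weight_aux:
  fixes t r d :: real
  assumes "0 < t" "0 < r" "0 \<le> d" "d \<le> 6 * t + r"
  shows "min (5 * t) r \<le> t * (16 * r / (r + d))"
proof -
  have "min (5 * t) r * (r + d) \<le> min (5 * t) r * (2 * r + 6 * t)"
    using assms by (intro mult_left_mono) auto
  also have "\<dots> = min (5 * t) r * (2 * r) + min (5 * t) r * (6 * t)" by (simp add: algebra_simps)
  also have "\<dots> \<le> (5 * t) * (2 * r) + r * (6 * t)"
    using assms by (intro add_mono mult_right_mono) auto
  finally have "min (5 * t) r * (r + d) \<le> t * (16 * r)" by (simp add: algebra_simps)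
  then show ?thesis using assms by (simp add: pos_le_divide_eq)
qed

text \<open>The contribution of one Vitali ball. The part of its dilate inside
  \<open>ball x0 r\<close> is small compared with \<open>ball z t\<close> when \<open>t\<close> is
  large, and the lost factor is dominated by the weight at every point of
  \<open>ball z t\<close>.\<close>

lemma weighted_ball_estimate:
  fixes g :: "'a::euclidean_space \<Rightarrow> ennreal" and z x0 :: 'a
  assumes g [measurable]: "g \<in> borel_measurable lebesgue" and t: "0 < t" and r: "0 < r" and s: "0 < s"
    and large: "ennreal s * emeasure lebesgue (ball z t) \<le> ball_mass g z t"
  shows "ennreal s * emeasure lebesgue (ball z (5 * t) \<inter> ball x0 r)
    \<le> ball_mass (\<lambda>y. g y * ennreal ((16 * r / (r + dist x0 y)) ^ DIM('a))) z t"
proof (cases "ball z (5 * t) \<inter> ball x0 r = {}")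
  case False
  then obtain u where "dist z u < 5 * t" "dist x0 u < r" by auto
  then have zx: "dist x0 z < 5 * t + r" using dist_triangle2[of x0 z u] by (simp add: dist_commute)
  let ?v = "measure lebesgue (ball (0::'a) 1)"
  let ?m = "min (5 * t) r"
  \<comment> \<open>Ratio of the bound for the measure of
    \<open>ball z (5 * t) \<inter> ball x0 r\<close> to the measure of
    \<open>ball z t\<close>.\<close>
  define w where "w = (?m / t) ^ DIM('a)"
  have w0: "0 \<le> w" using t r by (simp add: w_def)
  have weight: "w \<le> (16 * r / (r + dist x0 y)) ^ DIM('a)" if "y \<in> ball z t" for y
  proof -
    have "dist x0 y \<le> 6 * t + r" using that zx dist_triangle[of x0 y z] by simp
    then have "?m / t \<le> 16 * r / (r + dist x0 y)"
      using vitali_weight_aux[OF t r, of "dist x0 y"] t by (simp add: pos_divide_le_eq mult.commute)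
    then show ?thesis unfolding w_def using t r by (intro power_mono) auto
  qed
  have "emeasure lebesgue (ball z (5 * t) \<inter> ball x0 r) \<le> ennreal (?m ^ DIM('a) * ?v)"
  proof (cases "5 * t \<le> r")
    case True
    have "emeasure lebesgue (ball z (5 * t) \<inter> ball x0 r) \<le> emeasure lebesgue (ball z (5 * t))"
      by (intro emeasure_mono) auto
    also have "\<dots> = ennreal ((5 * t) ^ DIM('a) * ?v)" using t by (intro emeasure_lebesgue_ball) simp
    finally show ?thesis using True by (simp add: min_absorb1)
  next
    case False
    have "emeasure lebesgue (ball z (5 * t) \<inter> ball x0 r) \<le> emeasure lebesgue (ball x0 r)"
      by (intro emeasure_mono) auto
    also have "\<dots> = ennreal (r ^ DIM('a) * ?v)" using r by (intro emeasure_lebesgue_ball) simp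
    finally show ?thesis using False by (simp add: min_absorb2)
  qed
  then have "ennreal s * emeasure lebesgue (ball z (5 * t) \<inter> ball x0 r) \<le> ennreal s * ennreal (?m ^ DIM('a) * ?v)"
    by (intro mult_left_mono) auto
  also have "\<dots> = ennreal w * (ennreal s * emeasure lebesgue (ball z t))"
    unfolding emeasure_lebesgue_ball[OF less_imp_le[OF t]]
    using s t r w0 by (simp add: w_def power_divide flip: ennreal_mult)
  also have "\<dots> \<le> ennreal w * ball_mass g z t" using large by (intro mult_left_mono) auto
  also have "\<dots> = (\<integral>\<^sup>+ y. ennreal w * (g y * indicator (ball z t) y) \<partial>lebesgue)"
    unfolding ball_mass_def by (intro nn_integral_cmult[symmetric]) measurable
  also have "\<dots> \<le> ball_mass (\<lambda>y. g y * ennreal ((16 * r / (r + dist x0 y)) ^ DIM('a))) z t"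
    unfolding ball_mass_def
  proof (rule nn_integral_mono)
    fix y
    show "ennreal w * (g y * indicator (ball z t) y)
      \<le> g y * ennreal ((16 * r / (r + dist x0 y)) ^ DIM('a)) * indicator (ball z t) y"
    proof (cases "y \<in> ball z t")
      case True
      then have "g y * ennreal w \<le> g y * ennreal ((16 * r / (r + dist x0 y)) ^ DIM('a))"
        by (intro mult_left_mono ennreal_leI weight) auto
      with True show ?thesis by (simp add: mult.commute[of "ennreal w"])
    qed simp
  qed
  finally show ?thesis .
qed simp

text \<open>Subadditivity indexed by the countable set of Vitali centres itself, in the form that
  \<open>emeasure_UN_countable\<close> uses for the disjoint balls.\<close>

lemma emeasure_UN_le_count_space:
  assumes I: "countable I" and A: "\<And>i. i \<in> I \<Longrightarrow> A i \<in> sets M"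
  shows "emeasure M (\<Union>i\<in>I. A i) \<le> (\<integral>\<^sup>+ i. emeasure M (A i) \<partial>count_space I)"
proof -
  have "emeasure M (\<Union>i\<in>I. A i) = (\<integral>\<^sup>+ x. indicator (\<Union>i\<in>I. A i) x \<partial>M)"
    using I A by (intro nn_integral_indicator[symmetric] sets.countable_UN') auto
  also have "\<dots> \<le> (\<integral>\<^sup>+ x. (\<integral>\<^sup>+ i. indicator (A i) x \<partial>count_space I) \<partial>M)"
  proof (rule nn_integral_mono)
    fix x show "indicator (\<Union>i\<in>I. A i) x \<le> (\<integral>\<^sup>+ i. (indicator (A i) x :: ennreal) \<partial>count_space I)"
    proof (cases "x \<in> (\<Union>i\<in>I. A i)")
      case True
      then obtain i where i: "i \<in> I" "x \<in> A i" by auto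
      then show ?thesis
        using True nn_integral_ge_point[OF i(1), of "\<lambda>i. indicator (A i) x"] by simp
    qed simp
  qed
  also have "\<dots> = (\<integral>\<^sup>+ i. emeasure M (A i) \<partial>count_space I)"
    using I A by (subst nn_integral_count_space_nn_integral) (auto intro!: nn_integral_cong)
  finally show ?thesis .
qed

text \<open>The dilates of the selected balls cover \<open>E\<close>. Each dilate cut with
  \<open>ball x0 r\<close> is paid for by the weighted mass of its own ball, and since those balls
  are disjoint the payments add up to at most the whole integral.\<close>

lemma weighted_weak_type_radius:
  fixes g :: "'a::euclidean_space \<Rightarrow> ennreal" and x0 :: 'a and R :: real
  assumes g [measurable]: "g \<in> borel_measurable lebesgue" and r: "0 < r" and s: "0 < s"
  defines "E \<equiv> {x. \<exists>t\<in>{..R} \<inter> {0<..}. ennreal s * emeasure lebesgue (ball x t) < ball_mass g x t}"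
  defines "W \<equiv> \<lambda>y. g y * ennreal ((16 * r / (r + dist x0 y)) ^ DIM('a))"
  shows "ennreal s * emeasure lebesgue (E \<inter> ball x0 r) \<le> (\<integral>\<^sup>+ y. W y \<partial>lebesgue)"
proof -
  have "(\<lambda>y. ennreal ((16 * r / (r + dist x0 y)) ^ DIM('a))) \<in> borel_measurable lebesgue"
    by (intro measurable_completion) measurable
  then have W [measurable]: "W \<in> borel_measurable lebesgue"
    unfolding W_def by measurable
  have "\<forall>x\<in>E. \<exists>t. 0 < t \<and> t \<le> R \<and> ennreal s * emeasure lebesgue (ball x t) < ball_mass g x t"
    by (auto simp: E_def)
  from bchoice[OF this] obtain t
    where t: "\<forall>x\<in>E. 0 < t x \<and> t x \<le> R \<and> ennreal s * emeasure lebesgue (ball x (t x)) < ball_mass g x (t x)" ..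
  obtain C where C: "countable C" "C \<subseteq> E"
    and disj: "pairwise (\<lambda>i j. disjnt (cball i (t i)) (cball j (t j))) C"
    and cover: "\<And>i. i \<in> E \<Longrightarrow> \<exists>j. j \<in> C \<and> \<not> disjnt (cball i (t i)) (cball j (t j)) \<and> cball i (t i) \<subseteq> ball j (5 * t j)"
    using Vitali_covering_lemma_cballs_balls[of E t R "\<lambda>x. x"] t by blast
  define A where "A j = ball j (5 * t j) \<inter> ball x0 r" for j
  have "E \<inter> ball x0 r \<subseteq> (\<Union>j\<in>C. A j)"
  proof
    fix x assume x: "x \<in> E \<inter> ball x0 r"
    then obtain j where j: "j \<in> C" "cball x (t x) \<subseteq> ball j (5 * t j)" using cover by blast
    have "x \<in> cball x (t x)" using t x by (auto simp: less_imp_le)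
    with j x show "x \<in> (\<Union>j\<in>C. A j)" unfolding A_def by blast
  qed
  then have "emeasure lebesgue (E \<inter> ball x0 r) \<le> emeasure lebesgue (\<Union>j\<in>C. A j)"
    using C(1) by (intro emeasure_mono sets.countable_UN') (auto simp: A_def)
  also have "\<dots> \<le> (\<integral>\<^sup>+ j. emeasure lebesgue (A j) \<partial>count_space C)"
    using C(1) by (intro emeasure_UN_le_count_space) (auto simp: A_def)
  finally have "ennreal s * emeasure lebesgue (E \<inter> ball x0 r) \<le> ennreal s * (\<integral>\<^sup>+ j. emeasure lebesgue (A j) \<partial>count_space C)"
    by (intro mult_left_mono) auto
  also have "\<dots> = (\<integral>\<^sup>+ j. ennreal s * emeasure lebesgue (A j) \<partial>count_space C)"
    by (intro nn_integral_cmult[symmetric]) auto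
  also have "\<dots> \<le> (\<integral>\<^sup>+ j. emeasure (density lebesgue W) (ball j (t j)) \<partial>count_space C)"
    unfolding ball_mass_eq_emeasure_density[OF W, symmetric]
  proof (rule nn_integral_mono)
    fix j assume "j \<in> space (count_space C)"
    then have "j \<in> E" using C(2) by auto
    then have "0 < t j" "ennreal s * emeasure lebesgue (ball j (t j)) < ball_mass g j (t j)"
      using t by blast+
    then show "ennreal s * emeasure lebesgue (A j) \<le> ball_mass W j (t j)"
      unfolding A_def W_def by (intro weighted_ball_estimate g r s less_imp_le)
  qed
  also have "\<dots> = emeasure (density lebesgue W) (\<Union>j\<in>C. ball j (t j))"
  proof (intro emeasure_UN_countable[symmetric] C)
    show "disjoint_family_on (\<lambda>j. ball j (t j)) C"
      using disj unfolding disjoint_family_on_def pairwise_def disjnt_def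
      by (meson ball_subset_cball disjoint_iff subsetD)
  qed auto
  also have "\<dots> \<le> emeasure (density lebesgue W) UNIV" by (intro emeasure_mono) auto
  also have "\<dots> = (\<integral>\<^sup>+ y. W y \<partial>lebesgue)" by (subst emeasure_density) auto
  finally show ?thesis .
qed

text \<open>The bound does not depend on the maximal radius, so it survives the increasing union
  over \<open>{..real k}\<close>.\<close>

lemma weighted_weak_type:
  fixes g :: "'a::euclidean_space \<Rightarrow> ennreal" and x0 :: 'a
  assumes g: "g \<in> borel_measurable lebesgue" and r: "0 < r" and s: "0 < s"
  shows "ennreal s * emeasure lebesgue ({x. ennreal s < hl_maximal g x} \<inter> ball x0 r)
    \<le> (\<integral>\<^sup>+ y. g y * ennreal ((16 * r / (r + dist x0 y)) ^ DIM('a)) \<partial>lebesgue)"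
proof -
  define E where "E k = {x. \<exists>t\<in>{..real k} \<inter> {0<..}. ennreal s * emeasure lebesgue (ball x t) < ball_mass g x t}" for k :: nat
  have "{x. ennreal s < hl_maximal g x} = (\<Union>k. E k)"
  proof (intro equalityI subsetI)
    fix x assume "x \<in> {x. ennreal s < hl_maximal g x}"
    then obtain t where "0 < t" "ennreal s * emeasure lebesgue (ball x t) < ball_mass g x t"
      unfolding mem_Collect_eq less_hl_maximal_iff by blast
    moreover obtain k where "t \<le> real k" using real_arch_simple by blast
    ultimately have "x \<in> E k" unfolding E_def by blast
    then show "x \<in> (\<Union>k. E k)" by blast
  next
    fix x assume "x \<in> (\<Union>k. E k)"
    then show "x \<in> {x. ennreal s < hl_maximal g x}"
      unfolding mem_Collect_eq less_hl_maximal_iff E_def by blast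
  qed
  moreover have "(SUP k. emeasure lebesgue (E k \<inter> ball x0 r)) = emeasure lebesgue (\<Union>k. E k \<inter> ball x0 r)"
  proof (rule SUP_emeasure_incseq)
    show "range (\<lambda>k. E k \<inter> ball x0 r) \<subseteq> sets lebesgue"
      using open_less_hl_maximal_radius[OF g] by (auto simp: E_def intro!: borel_open)
    show "incseq (\<lambda>k. E k \<inter> ball x0 r)" by (fastforce simp: incseq_def E_def)
  qed
  ultimately have "ennreal s * emeasure lebesgue ({x. ennreal s < hl_maximal g x} \<inter> ball x0 r)
    = ennreal s * (SUP k. emeasure lebesgue (E k \<inter> ball x0 r))"
    by simp
  also have "\<dots> = (SUP k. ennreal s * emeasure lebesgue (E k \<inter> ball x0 r))"
    by (rule SUP_mult_left_ennreal)
  also have "\<dots> \<le> (\<integral>\<^sup>+ y. g y * ennreal ((16 * r / (r + dist x0 y)) ^ DIM('a)) \<partial>lebesgue)"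
    unfolding E_def by (intro SUP_least weighted_weak_type_radius g r s)
  finally show ?thesis .
qed

section \<open>From the weak type to the strong type by layers\<close>

text \<open>The part of \<open>g\<close> not exceeding \<open>s\<close> contributes at most
  \<open>s\<close> to any average.\<close>

lemma hl_maximal_le_truncated:
  fixes g :: "'a::euclidean_space \<Rightarrow> ennreal" and s :: real
  assumes [measurable]: "g \<in> borel_measurable lebesgue" and s: "0 < s"
  shows "hl_maximal g x \<le> hl_maximal (\<lambda>y. if ennreal s < g y then g y else 0) x + ennreal s"
  unfolding hl_maximal_def[of g]
proof (rule SUP_least)
  fix t :: real assume "t \<in> {0<..}"
  then have t: "0 < t" by simp
  define v where "v = t ^ DIM('a) * measure lebesgue (ball (0::'a) 1)"
  have v: "0 < v" using t measure_lebesgue_unit_ball_pos[where 'a='a] by (simp add: v_def)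
  have B: "emeasure lebesgue (ball x t) = ennreal v"
    unfolding v_def using t by (intro emeasure_lebesgue_ball) simp
  let ?h = "\<lambda>y. if ennreal s < g y then g y else 0"
  have "ball_mass g x t \<le> (\<integral>\<^sup>+ y. ?h y * indicator (ball x t) y + ennreal s * indicator (ball x t) y \<partial>lebesgue)"
    unfolding ball_mass_def by (intro nn_integral_mono) (auto simp: indicator_def)
  also have "\<dots> = ball_mass ?h x t + ennreal s * emeasure lebesgue (ball x t)"
    unfolding ball_mass_def by (subst nn_integral_add) (auto simp: nn_integral_cmult)
  finally have "ball_mass g x t / ennreal v \<le> (ball_mass ?h x t + ennreal s * ennreal v) / ennreal v"
    unfolding B by (rule divide_right_mono_ennreal)
  also have "\<dots> = ball_mass ?h x t / ennreal v + ennreal s"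
    using v s by (simp add: add_divide_distrib_ennreal divide_ennreal flip: ennreal_mult)
  also have "\<dots> \<le> hl_maximal ?h x + ennreal s"
    unfolding hl_maximal_def B[symmetric] using t by (intro add_right_mono SUP_upper) auto
  finally show "ball_mass g x t / emeasure lebesgue (ball x t) \<le> hl_maximal ?h x + ennreal s"
    unfolding B .
qed

lemma nn_integral_powr_derivative:
  assumes q: "0 < q" and c: "0 \<le> c"
  shows "(\<integral>\<^sup>+ s. ennreal (s powr (q - 1)) * indicator {0<..<c} s \<partial>lborel) = ennreal (c powr q / q)"
proof -
  have "((\<lambda>s. s powr (q - 1)) has_integral (c powr (q - 1 + 1) / (q - 1 + 1))) {0..c}"
    using q c by (intro has_integral_powr_from_0) auto
  then have "((\<lambda>s. s powr (q - 1)) has_integral (c powr q / q)) {0<..<c}"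
    by (simp add: has_integral_Icc_iff_Ioo)
  then show ?thesis by (intro nn_integral_has_integral_lebesgue') auto
qed

text \<open>The \<open>p\<close>-th power on the extended half-line, written as its layer-cake
  integral. Infinity is mapped to infinity, and the integral over levels is ready for
  Fubini.\<close>

definition layer_power :: "real \<Rightarrow> ennreal \<Rightarrow> ennreal" where
  "layer_power p u = (\<integral>\<^sup>+ s. ennreal (p * s powr (p - 1)) * indicator {s. 0 < s \<and> ennreal s < u} s \<partial>lborel)"

lemma layer_power_ennreal:
  assumes p: "0 < p" and c: "0 \<le> c"
  shows "layer_power p (ennreal c) = ennreal (c powr p)"
proof -
  have "{s. 0 < s \<and> ennreal s < ennreal c} = {0<..<c}" by (auto simp: ennreal_less_iff)
  then have "layer_power p (ennreal c)
    = (\<integral>\<^sup>+ s. ennreal p * (ennreal (s powr (p - 1)) * indicator {0<..<c} s) \<partial>lborel)"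
    unfolding layer_power_def using p by (simp add: ennreal_mult mult.assoc)
  also have "\<dots> = ennreal p * ennreal (c powr p / p)"
    by (subst nn_integral_cmult) (auto simp: nn_integral_powr_derivative[OF p c])
  finally show ?thesis using p by (simp flip: ennreal_mult)
qed

lemma layer_power_top:
  assumes p: "0 < p"
  shows "layer_power p top = top"
proof (rule ccontr)
  assume "layer_power p top \<noteq> top"
  then obtain a where a: "0 \<le> a" "layer_power p top = ennreal a" by (cases "layer_power p top") auto
  \<comment> \<open>The level is chosen with \<open>p\<close>-th power \<open>a + 1\<close>, above
    the supposed finite value \<open>a\<close>.\<close>
  have "layer_power p (ennreal ((a + 1) powr (1 / p))) \<le> layer_power p top"
    unfolding layer_power_def by (intro nn_integral_mono) (auto simp: indicator_def)
  then show False using p a by (simp add: layer_power_ennreal powr_powr)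
qed

text \<open>Discarding the part of \<open>g\<close> up to \<open>s / 2\<close> lowers the maximal
  function by at most \<open>s / 2\<close>. So the weak type may be used for the truncation at
  height \<open>s / 2\<close>, which costs the factor 2.\<close>

lemma weighted_layer_estimate:
  fixes g :: "'a::euclidean_space \<Rightarrow> ennreal" and x0 :: 'a
  assumes g [measurable]: "g \<in> borel_measurable lebesgue" and r: "0 < r" and s: "0 < s"
  shows "ennreal s * emeasure lebesgue ({x. ennreal s < hl_maximal g x} \<inter> ball x0 r)
    \<le> 2 * (\<integral>\<^sup>+ y. g y * indicator {y. ennreal (s / 2) < g y} y
        * ennreal ((16 * r / (r + dist x0 y)) ^ DIM('a)) \<partial>lebesgue)"
proof -
  let ?h = "\<lambda>y. if ennreal (s / 2) < g y then g y else 0"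
  have sub: "{x. ennreal s < hl_maximal g x} \<subseteq> {x. ennreal (s / 2) < hl_maximal ?h x}"
  proof (intro subsetI CollectI)
    fix x assume "x \<in> {x. ennreal s < hl_maximal g x}"
    then have "ennreal s < hl_maximal g x" by simp
    also have "\<dots> \<le> hl_maximal ?h x + ennreal (s / 2)"
      using s by (intro hl_maximal_le_truncated) auto
    finally show "ennreal (s / 2) < hl_maximal ?h x"
    proof (rule contrapos_pp)
      assume "\<not> ennreal (s / 2) < hl_maximal ?h x"
      then have "hl_maximal ?h x + ennreal (s / 2) \<le> ennreal (s / 2) + ennreal (s / 2)"
        by (intro add_right_mono) simp
      also have "\<dots> = ennreal s" using s by (simp flip: ennreal_plus)
      finally show "\<not> ennreal s < hl_maximal ?h x + ennreal (s / 2)" by simp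
    qed
  qed
  have "{x. ennreal (s / 2) < hl_maximal ?h x} \<in> sets borel"
    using borel_measurable_hl_maximal[of ?h] by measurable
  then have "emeasure lebesgue ({x. ennreal s < hl_maximal g x} \<inter> ball x0 r)
      \<le> emeasure lebesgue ({x. ennreal (s / 2) < hl_maximal ?h x} \<inter> ball x0 r)"
    using sub by (intro emeasure_mono) auto
  then have "ennreal s * emeasure lebesgue ({x. ennreal s < hl_maximal g x} \<inter> ball x0 r)
      \<le> ennreal s * emeasure lebesgue ({x. ennreal (s / 2) < hl_maximal ?h x} \<inter> ball x0 r)"
    by (rule mult_left_mono) simp
  also have "\<dots> = 2 * (ennreal (s / 2) * emeasure lebesgue ({x. ennreal (s / 2) < hl_maximal ?h x} \<inter> ball x0 r))"
    using s by (simp add: ennreal_mult[symmetric] mult.assoc[symmetric] ennreal_numeral[symmetric]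
        del: ennreal_numeral)
  also have "\<dots> \<le> 2 * (\<integral>\<^sup>+ y. ?h y * ennreal ((16 * r / (r + dist x0 y)) ^ DIM('a)) \<partial>lebesgue)"
    using s r by (intro mult_left_mono weighted_weak_type) auto
  also have "(\<integral>\<^sup>+ y. ?h y * ennreal ((16 * r / (r + dist x0 y)) ^ DIM('a)) \<partial>lebesgue)
    = (\<integral>\<^sup>+ y. g y * indicator {y. ennreal (s / 2) < g y} y
        * ennreal ((16 * r / (r + dist x0 y)) ^ DIM('a)) \<partial>lebesgue)"
    by (intro nn_integral_cong) auto
  finally show ?thesis .
qed

text \<open>
  The layer-cake formula on both sides: the weak-type estimate at height \<open>s\<close> sees only the part of
  \<open>g\<close> above \<open>s / 2\<close>, so integrating \<open>s powr (p - 2)\<close> over \<open>s < 2 * g y\<close> recovers \<open>g y powr (p - 1)\<close>.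
\<close>

lemma weighted_strong_type:
  fixes g :: "'a::euclidean_space \<Rightarrow> real" and x0 :: 'a
  assumes p: "1 < p" and g [measurable]: "g \<in> borel_measurable lebesgue" and g0: "\<And>y. 0 \<le> g y" and r: "0 < r"
  shows "(\<integral>\<^sup>+ x\<in>ball x0 r. layer_power p (hl_maximal (\<lambda>y. ennreal (g y)) x) \<partial>lebesgue)
    \<le> ennreal (2 * p * 2 powr (p - 1) / (p - 1))
      * (\<integral>\<^sup>+ y. ennreal (g y powr p) * ennreal ((16 * r / (r + dist x0 y)) ^ DIM('a)) \<partial>lebesgue)"
proof -
  interpret leb: sigma_finite_measure "lebesgue :: 'a measure" by (rule sigma_finite_lebesgue)
  interpret pair: pair_sigma_finite "lborel :: real measure" "lebesgue :: 'a measure" ..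
  define M where "M = hl_maximal (\<lambda>y. ennreal (g y))"
  have "M \<in> borel_measurable lborel" unfolding M_def by (simp add: borel_measurable_hl_maximal)
  then have M [measurable]: "M \<in> borel_measurable lebesgue" by (rule measurable_completion)
  define W where "W y = ennreal ((16 * r / (r + dist x0 y)) ^ DIM('a))" for y
  have W [measurable]: "W \<in> borel_measurable lebesgue"
    unfolding W_def by (intro measurable_completion) measurable
  define k where "k s = ennreal (p * s powr (p - 1)) * indicator {0<..} s" for s :: real
  have k [measurable]: "k \<in> borel_measurable borel" unfolding k_def by measurable
  \<comment> \<open>What remains of \<open>k s\<close> after the weak type has absorbed one factor
    \<open>s\<close>, with the 2 from the truncation. It is integrable near 0 because
    \<open>1 < p\<close>.\<close>
  define l where "l s = ennreal (2 * p * s powr (p - 2)) * indicator {0<..} s" for s :: real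
  have l [measurable]: "l \<in> borel_measurable borel" unfolding l_def by measurable
  \<comment> \<open>The level condition is written with \<open>if\<close>, a measurable function of
    the pair of \<open>s\<close> and \<open>x\<close>, as Fubini requires.\<close>
  have "(\<integral>\<^sup>+ x\<in>ball x0 r. layer_power p (M x) \<partial>lebesgue)
    = (\<integral>\<^sup>+ x. (\<integral>\<^sup>+ s. k s * (if ennreal s < M x then 1 else 0) * indicator (ball x0 r) x \<partial>lborel) \<partial>lebesgue)"
  proof (rule nn_integral_cong)
    fix x
    have "layer_power p (M x) = (\<integral>\<^sup>+ s. k s * (if ennreal s < M x then 1 else 0) \<partial>lborel)"
      unfolding layer_power_def k_def by (intro nn_integral_cong) (auto simp: indicator_def)
    then show "layer_power p (M x) * indicator (ball x0 r) x
      = (\<integral>\<^sup>+ s. k s * (if ennreal s < M x then 1 else 0) * indicator (ball x0 r) x \<partial>lborel)"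
      by (simp add: nn_integral_multc)
  qed
  also have "\<dots> = (\<integral>\<^sup>+ s. (\<integral>\<^sup>+ x. k s * (if ennreal s < M x then 1 else 0) * indicator (ball x0 r) x \<partial>lebesgue) \<partial>lborel)"
    by (rule pair.Fubini') measurable
  also have "\<dots> \<le> (\<integral>\<^sup>+ s. (\<integral>\<^sup>+ y. l s * (if ennreal (s / 2) < ennreal (g y) then 1 else 0) * (ennreal (g y) * W y) \<partial>lebesgue) \<partial>lborel)"
  proof (rule nn_integral_mono)
    fix s :: real
    show "(\<integral>\<^sup>+ x. k s * (if ennreal s < M x then 1 else 0) * indicator (ball x0 r) x \<partial>lebesgue)
      \<le> (\<integral>\<^sup>+ y. l s * (if ennreal (s / 2) < ennreal (g y) then 1 else 0) * (ennreal (g y) * W y) \<partial>lebesgue)"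
    proof (cases "0 < s")
      case True
      have "(\<integral>\<^sup>+ x. k s * (if ennreal s < M x then 1 else 0) * indicator (ball x0 r) x \<partial>lebesgue)
        = (\<integral>\<^sup>+ x. k s * indicator ({x. ennreal s < M x} \<inter> ball x0 r) x \<partial>lebesgue)"
        by (intro nn_integral_cong) (auto simp: indicator_def)
      also have "\<dots> = k s * emeasure lebesgue ({x. ennreal s < M x} \<inter> ball x0 r)"
        by (rule nn_integral_cmult_indicator) measurable
      also have "\<dots> = ennreal (p * s powr (p - 2)) * (ennreal s * emeasure lebesgue ({x. ennreal s < M x} \<inter> ball x0 r))"
      proof -
        have "s powr (p - 1) = s powr (p - 2) * s"
          using True powr_add[of s "p - 2" 1] by simp
        then show ?thesis using True p
          by (simp add: k_def mult.assoc[symmetric] ennreal_mult[symmetric] del: emeasure_completion)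
      qed
      also have "\<dots> \<le> ennreal (p * s powr (p - 2)) * (2 * (\<integral>\<^sup>+ y. ennreal (g y) * indicator {y. ennreal (s / 2) < ennreal (g y)} y * W y \<partial>lebesgue))"
        unfolding M_def W_def using True by (intro mult_left_mono weighted_layer_estimate r) auto
      also have "\<dots> = l s * (\<integral>\<^sup>+ y. ennreal (g y) * indicator {y. ennreal (s / 2) < ennreal (g y)} y * W y \<partial>lebesgue)"
        using True p by (simp add: l_def mult.assoc[symmetric] ennreal_mult[symmetric] ennreal_numeral[symmetric] mult.commute[of _ 2]
            del: ennreal_numeral)
      also have "\<dots> = (\<integral>\<^sup>+ y. l s * (ennreal (g y) * indicator {y. ennreal (s / 2) < ennreal (g y)} y * W y) \<partial>lebesgue)"
        by (intro nn_integral_cmult[symmetric]) measurable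
      also have "\<dots> = (\<integral>\<^sup>+ y. l s * (if ennreal (s / 2) < ennreal (g y) then 1 else 0) * (ennreal (g y) * W y) \<partial>lebesgue)"
        by (intro nn_integral_cong) (auto simp: mult.assoc)
      finally show ?thesis .
    qed (simp add: k_def)
  qed
  also have "\<dots> = (\<integral>\<^sup>+ y. (\<integral>\<^sup>+ s. l s * (if ennreal (s / 2) < ennreal (g y) then 1 else 0) * (ennreal (g y) * W y) \<partial>lborel) \<partial>lebesgue)"
    by (rule pair.Fubini'[symmetric]) measurable
  also have "\<dots> = (\<integral>\<^sup>+ y. ennreal (2 * p * 2 powr (p - 1) / (p - 1)) * (ennreal (g y powr p) * W y) \<partial>lebesgue)"
  proof (rule nn_integral_cong)
    fix y
    have "(\<integral>\<^sup>+ s. l s * (if ennreal (s / 2) < ennreal (g y) then 1 else 0) \<partial>lborel)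
      = (\<integral>\<^sup>+ s. ennreal (2 * p) * (ennreal (s powr (p - 1 - 1)) * indicator {0<..<2 * g y} s) \<partial>lborel)"
      using p g0[of y] by (intro nn_integral_cong) (auto simp: l_def indicator_def ennreal_less_iff ennreal_mult)
    also have "\<dots> = ennreal (2 * p) * ennreal ((2 * g y) powr (p - 1) / (p - 1))"
      using nn_integral_powr_derivative[of "p - 1" "2 * g y"] p g0[of y]
      by (subst nn_integral_cmult) auto
    also have "\<dots> = ennreal (2 * p * 2 powr (p - 1) / (p - 1) * g y powr (p - 1))"
      using p g0[of y] by (simp add: powr_mult flip: ennreal_mult)
    finally have *: "(\<integral>\<^sup>+ s. l s * (if ennreal (s / 2) < ennreal (g y) then 1 else 0) \<partial>lborel)
      = ennreal (2 * p * 2 powr (p - 1) / (p - 1) * g y powr (p - 1))" .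
    have "g y powr (p - 1) * g y = g y powr p"
      using g0[of y] p powr_add[of "g y" "p - 1" 1] by (cases "g y = 0") auto
    then have "ennreal (2 * p * 2 powr (p - 1) / (p - 1) * g y powr (p - 1)) * ennreal (g y)
      = ennreal (2 * p * 2 powr (p - 1) / (p - 1)) * ennreal (g y powr p)"
      using p g0[of y] by (simp add: mult.assoc flip: ennreal_mult)
    then show "(\<integral>\<^sup>+ s. l s * (if ennreal (s / 2) < ennreal (g y) then 1 else 0) * (ennreal (g y) * W y) \<partial>lborel)
      = ennreal (2 * p * 2 powr (p - 1) / (p - 1)) * (ennreal (g y powr p) * W y)"
      by (subst nn_integral_multc) (auto simp: * mult.assoc[symmetric])
  qed
  also have "\<dots> = ennreal (2 * p * 2 powr (p - 1) / (p - 1)) * (\<integral>\<^sup>+ y. ennreal (g y powr p) * W y \<partial>lebesgue)"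
    by (intro nn_integral_cmult) measurable
  finally show ?thesis unfolding M_def W_def .
qed

text \<open>Only the term of the least \<open>k\<close> with \<open>dist x0 y < 2 ^ k * r\<close> is
  used. By minimality \<open>2 ^ k * r \<le> 2 * (r + dist x0 y)\<close>, which turns 16 into
  32.\<close>

lemma dyadic_weight_le:
  fixes x0 y :: "'a::euclidean_space"
  assumes r: "0 < r"
  shows "ennreal ((16 * r / (r + dist x0 y)) ^ DIM('a))
    \<le> ennreal (32 ^ DIM('a)) * (\<Sum>k. ennreal ((1 / 2 ^ DIM('a)) ^ k) * indicator (ball x0 (2 ^ k * r)) y)"
proof -
  let ?d = "dist x0 y" and ?n = "DIM('a)"
  have "\<exists>k::nat. ?d < 2 ^ k * r"
    using real_arch_pow[of 2 "?d / r"] r by (auto simp: field_simps)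
  define k where "k = (LEAST k::nat. ?d < 2 ^ k * r)"
  have k: "?d < 2 ^ k * r" unfolding k_def using \<open>\<exists>k::nat. ?d < 2 ^ k * r\<close> by (rule LeastI_ex)
  have "2 ^ k * r \<le> 2 * (r + ?d)"
  proof (cases k)
    case (Suc j)
    then have "\<not> ?d < 2 ^ j * r" using not_less_Least[of j "\<lambda>k. ?d < 2 ^ k * r"] by (simp add: k_def)
    then show ?thesis using Suc r by simp
  qed (use r in simp)
  then have "16 * r / (r + ?d) \<le> 32 * (1 / 2) ^ k"
    using r by (simp add: field_simps power_divide add_pos_nonneg)
  then have "(16 * r / (r + ?d)) ^ ?n \<le> (32 * (1 / 2) ^ k) ^ ?n"
    using r by (intro power_mono) auto
  also have "\<dots> = 32 ^ ?n * (1 / 2 ^ ?n) ^ k"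
    by (simp add: power_mult_distrib power_divide flip: power_mult)
  finally have "ennreal ((16 * r / (r + ?d)) ^ ?n) \<le> ennreal (32 ^ ?n) * ennreal ((1 / 2 ^ ?n) ^ k)"
    by (simp add: ennreal_leI flip: ennreal_mult)
  also have "\<dots> = ennreal (32 ^ ?n) * (ennreal ((1 / 2 ^ ?n) ^ k) * indicator (ball x0 (2 ^ k * r)) y)"
    using k by simp
  also have "\<dots> \<le> ennreal (32 ^ ?n) * (\<Sum>k. ennreal ((1 / 2 ^ ?n) ^ k) * indicator (ball x0 (2 ^ k * r)) y)"
  proof (rule mult_left_mono)
    define T :: "nat \<Rightarrow> ennreal" where "T k = ennreal ((1 / 2 ^ ?n) ^ k) * indicator (ball x0 (2 ^ k * r)) y" for k
    have "sum T {k} \<le> suminf T" by (rule sum_le_suminf) auto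
    then have "T k \<le> suminf T" by simp
    then show "ennreal ((1 / 2 ^ ?n) ^ k) * indicator (ball x0 (2 ^ k * r)) y
      \<le> (\<Sum>k. ennreal ((1 / 2 ^ ?n) ^ k) * indicator (ball x0 (2 ^ k * r)) y)"
      unfolding T_def .
  qed simp
  finally show ?thesis .
qed

lemma layer_power_hl_maximal_dominated_sum:
  fixes g :: "'a::euclidean_space \<Rightarrow> real" and x :: 'a
  assumes p: "1 < p" and g [measurable]: "g \<in> borel_measurable lebesgue" and g0: "\<And>y. 0 \<le> g y" and r: "0 < r"
  shows "ball_mass (\<lambda>y. layer_power p (hl_maximal (\<lambda>y. ennreal (g y)) y)) x r
    \<le> ennreal (2 * p * 2 powr (p - 1) / (p - 1) * 32 ^ DIM('a))
      * (\<Sum>k. ennreal ((1 / 2 ^ DIM('a)) ^ k) * ball_mass (\<lambda>y. ennreal (g y powr p)) x (2 ^ k * r))"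
proof -
  let ?A = "2 * p * 2 powr (p - 1) / (p - 1)" and ?n = "DIM('a)"
  have "ball_mass (\<lambda>y. layer_power p (hl_maximal (\<lambda>y. ennreal (g y)) y)) x r
    \<le> ennreal ?A * (\<integral>\<^sup>+ y. ennreal (g y powr p) * ennreal ((16 * r / (r + dist x y)) ^ ?n) \<partial>lebesgue)"
    unfolding ball_mass_def by (rule weighted_strong_type[OF p g g0 r])
  also have "(\<integral>\<^sup>+ y. ennreal (g y powr p) * ennreal ((16 * r / (r + dist x y)) ^ ?n) \<partial>lebesgue)
    \<le> (\<integral>\<^sup>+ y. ennreal (32 ^ ?n) * (\<Sum>k. ennreal ((1 / 2 ^ ?n) ^ k)
          * (ennreal (g y powr p) * indicator (ball x (2 ^ k * r)) y)) \<partial>lebesgue)"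
  proof (rule nn_integral_mono)
    fix y
    have "ennreal (g y powr p) * ennreal ((16 * r / (r + dist x y)) ^ ?n)
      \<le> ennreal (g y powr p) * (ennreal (32 ^ ?n) * (\<Sum>k. ennreal ((1 / 2 ^ ?n) ^ k) * indicator (ball x (2 ^ k * r)) y))"
      by (intro mult_left_mono dyadic_weight_le r) auto
    also have "\<dots> = ennreal (32 ^ ?n) * (\<Sum>k. ennreal (g y powr p) * (ennreal ((1 / 2 ^ ?n) ^ k) * indicator (ball x (2 ^ k * r)) y))"
      by (simp only: ennreal_suminf_cmult mult.left_commute)
    finally show "ennreal (g y powr p) * ennreal ((16 * r / (r + dist x y)) ^ ?n)
      \<le> ennreal (32 ^ ?n) * (\<Sum>k. ennreal ((1 / 2 ^ ?n) ^ k) * (ennreal (g y powr p) * indicator (ball x (2 ^ k * r)) y))"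
      by (simp only: mult.left_commute)
  qed
  also have "\<dots> = ennreal (32 ^ ?n) * (\<Sum>k. ennreal ((1 / 2 ^ ?n) ^ k) * ball_mass (\<lambda>y. ennreal (g y powr p)) x (2 ^ k * r))"
    unfolding ball_mass_def
    by (subst nn_integral_cmult, measurable, subst nn_integral_suminf, measurable, subst nn_integral_cmult, measurable)
  finally have "ball_mass (\<lambda>y. layer_power p (hl_maximal (\<lambda>y. ennreal (g y)) y)) x r
    \<le> ennreal ?A * (ennreal (32 ^ ?n) * (\<Sum>k. ennreal ((1 / 2 ^ ?n) ^ k) * ball_mass (\<lambda>y. ennreal (g y powr p)) x (2 ^ k * r)))"
    by (simp add: mult_left_mono)
  moreover have "ennreal (?A * 32 ^ ?n) = ennreal ?A * ennreal (32 ^ ?n)"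
    using p by (intro ennreal_mult) auto
  ultimately show ?thesis by (simp only: mult.assoc)
qed

lemma borel_measurable_maximal_function:
  fixes f :: "'a::euclidean_space \<Rightarrow> 'b::{banach, second_countable_topology}"
  assumes [measurable]: "f \<in> borel_measurable lebesgue"
  shows "maximal_function f \<in> borel_measurable borel"
  unfolding maximal_function_eq_hl_maximal by (intro borel_measurable_hl_maximal) measurable

section \<open>The maximal function on vanishing Morrey spaces\<close>

lemma AE_finite_if_mass_bound:
  fixes G :: "'a::euclidean_space \<Rightarrow> ennreal"
  assumes [measurable]: "G \<in> borel_measurable lebesgue" and K: "mass_bound lam K G"
  shows "AE x in lebesgue. G x < \<infinity>"
proof -
  have "AE x in lebesgue. G x * indicator (ball 0 (real (Suc j))) x \<noteq> \<infinity>" for j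
  proof (rule nn_integral_PInf_AE)
    have "ball_mass G 0 (real (Suc j)) < \<infinity>"
      using K unfolding mass_bound_def by (metis ennreal_less_top infinity_ennreal_def of_nat_0_less_iff
          order_le_less_trans zero_less_Suc)
    then show "(\<integral>\<^sup>+ x. G x * indicator (ball 0 (real (Suc j))) x \<partial>lebesgue) \<noteq> \<infinity>"
      unfolding ball_mass_def by simp
  qed measurable
  then have "AE x in lebesgue. \<forall>j. G x * indicator (ball 0 (real (Suc j))) x \<noteq> \<infinity>"
    unfolding AE_all_countable by blast
  then show ?thesis
  proof eventually_elim
    case (elim x)
    obtain j where "norm x < real j" using reals_Archimedean2 by blast
    then have "x \<in> ball 0 (real (Suc j))" by simp
    then show ?case using elim[rule_format, of j] by (simp add: less_top)
  qed
qed

lemma borel_measurable_layer_power [measurable]: "layer_power p \<in> borel_measurable borel"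
  unfolding layer_power_def indicator_def by measurable

text \<open>For \<open>u = top\<close> and \<open>A = 0\<close> the hypothesis still forces
  \<open>a = 0\<close>, because \<open>0 * top = 0\<close>.\<close>

lemma powr_le_layer_power:
  assumes p: "0 < p" and a: "0 \<le> a" "0 \<le> A" "ennreal a \<le> ennreal A * u"
  shows "ennreal (a powr p) \<le> ennreal (A powr p) * layer_power p u"
proof (cases u)
  case (real c)
  then have "a \<le> A * c" using a by (simp flip: ennreal_mult)
  then have "a powr p \<le> (A * c) powr p" using p a by (intro powr_mono2) auto
  then show ?thesis using real p a by (simp add: layer_power_ennreal powr_mult ennreal_leI flip: ennreal_mult)
next
  case top
  show ?thesis
  proof (cases "A = 0")
    case True
    then have "a = 0" using a by simp
    then show ?thesis using p by simp
  next
    case False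
    then show ?thesis using top a p by (simp add: layer_power_top ennreal_mult_top)
  qed
qed

text \<open>The constant of the strong-type inequality times the constant of the dyadic splitting of
  the weight.\<close>

definition maximal_const :: "real \<Rightarrow> nat \<Rightarrow> real" where
  "maximal_const p n = 2 * p * 2 powr (p - 1) / (p - 1) * 32 ^ n"

lemma maximal_const_nonneg: "1 < p \<Longrightarrow> 0 \<le> maximal_const p n"
  by (simp add: maximal_const_def)

text \<open>The common form of the estimate for all operators pointwise below a multiple of
  \<open>M f\<close>: \<open>A = 1\<close> for \<open>M\<close>, \<open>A = 2\<close> for the sharp
  function, and \<open>3 ^ n\<close> times the unit ball volume for Hardy averages.\<close>

lemma maximal_dominated_sum:
  fixes f :: "'a::euclidean_space \<Rightarrow> 'b::{banach, second_countable_topology}" and h :: "'a \<Rightarrow> real"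
  assumes p: "1 < p" and [measurable]: "f \<in> borel_measurable lebesgue" and r: "0 < r"
    and A: "0 \<le> A" and h0: "\<And>y. 0 \<le> h y" and h: "\<And>y. ennreal (h y) \<le> ennreal A * maximal_function f y"
  shows "ball_mass (\<lambda>y. ennreal (h y powr p)) x r
    \<le> ennreal (A powr p * maximal_const p DIM('a))
      * (\<Sum>k. ennreal ((1 / 2 ^ DIM('a)) ^ k) * ball_mass (\<lambda>y. ennreal (norm (f y) powr p)) x (2 ^ k * r))"
proof -
  have [measurable]: "maximal_function f \<in> borel_measurable lebesgue"
    by (intro measurable_completion) (simp add: borel_measurable_maximal_function)
  have "ball_mass (\<lambda>y. ennreal (h y powr p)) x r
    \<le> (\<integral>\<^sup>+ y. ennreal (A powr p) * (layer_power p (maximal_function f y) * indicator (ball x r) y) \<partial>lebesgue)"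
    unfolding ball_mass_def mult.assoc[symmetric] using p A h0 h
    by (intro nn_integral_mono mult_right_mono powr_le_layer_power) auto
  also have "\<dots> = ennreal (A powr p) * ball_mass (\<lambda>y. layer_power p (hl_maximal (\<lambda>y. ennreal (norm (f y))) y)) x r"
    unfolding ball_mass_def maximal_function_eq_hl_maximal[symmetric] by (intro nn_integral_cmult) measurable
  also have "\<dots> \<le> ennreal (A powr p) * (ennreal (maximal_const p DIM('a))
      * (\<Sum>k. ennreal ((1 / 2 ^ DIM('a)) ^ k) * ball_mass (\<lambda>y. ennreal (norm (f y) powr p)) x (2 ^ k * r)))"
    unfolding maximal_const_def
    by (intro mult_left_mono layer_power_hl_maximal_dominated_sum p r) auto
  finally show ?thesis using maximal_const_nonneg[OF p] by (simp add: ennreal_mult mult.assoc)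
qed

text \<open>This is how \<open>lam < n\<close> enters the maximal estimates.\<close>

lemma dyadic_ratio_less_1:
  assumes "lam < real n"
  shows "1 / 2 ^ n * 2 powr lam < (1::real)"
proof -
  have "2 powr lam < (2::real) powr real n" using assms by (intro powr_less_mono) auto
  then show ?thesis by (simp add: powr_realpow)
qed

text \<open>The mass bound is applied to the extended power of \<open>M f\<close>, in which infinite
  values of \<open>M f\<close> remain visible, so it excludes them almost everywhere.\<close>

lemma AE_maximal_function_finite:
  fixes f :: "'a::euclidean_space \<Rightarrow> 'b::{banach, second_countable_topology}"
  assumes p: "1 < p" and lam: "lam < real DIM('a)" and f: "f \<in> morrey_space p lam"
  shows "AE x in lebesgue. maximal_function f x < \<infinity>"
proof -
  have fm [measurable]: "f \<in> borel_measurable lebesgue" using f p by (simp add: morrey_space_iff)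
  have [measurable]: "maximal_function f \<in> borel_measurable lebesgue"
    by (intro measurable_completion) (simp add: borel_measurable_maximal_function)
  obtain K where K: "0 \<le> K" "mass_bound lam K (\<lambda>y. ennreal (norm (f y) powr p))"
    using f p by (auto simp: morrey_space_iff)
  have "mass_bound lam (maximal_const p DIM('a) / (1 - 1 / 2 ^ DIM('a) * 2 powr lam) * K)
    (\<lambda>y. layer_power p (maximal_function f y))"
    using layer_power_hl_maximal_dominated_sum[OF p, of "\<lambda>y. norm (f y)"] K maximal_const_nonneg[OF p] dyadic_ratio_less_1[OF lam]
    by (intro dominated_sum_mass_bound[where F="\<lambda>y. ennreal (norm (f y) powr p)" and c="\<lambda>_. 1"])
       (auto simp: maximal_function_eq_hl_maximal maximal_const_def)
  then have "AE x in lebesgue. layer_power p (maximal_function f x) < \<infinity>"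
    by (rule AE_finite_if_mass_bound[rotated]) measurable
  then show ?thesis
  proof eventually_elim
    case (elim x)
    then show ?case using p by (cases "maximal_function f x") (auto simp: layer_power_top)
  qed
qed

lemma ennreal_enn2real_le: "ennreal (enn2real u) \<le> u"
  by (cases u) auto

text \<open>Replacing infinite values by 0 through \<open>enn2real\<close> only decreases
  \<open>M f\<close>, so the mass estimate holds as it stands; that this changes a null set only is
  the separate almost-everywhere claim.\<close>

lemma maximal_function_bounded:
  fixes p lam :: real
  assumes p: "1 < p" and lam: "0 \<le> lam" "lam < real DIM('a::euclidean_space)"
  shows "bounded_in_vanishing_morrey p lam
    (\<lambda>(f :: 'a \<Rightarrow> 'b::{banach, second_countable_topology}) x. maximal_function f x < \<infinity>)
    (\<lambda>f x. enn2real (maximal_function f x))"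
proof (rule bounded_in_vanishing_morrey_dominated[OF _ _ _ _ _ _ bounded_in_vanishing_morrey_id, where C="1 powr p * maximal_const p DIM('a)" and b="1 / 2 ^ DIM('a)" and c="\<lambda>_. 1"])
  fix f :: "'a \<Rightarrow> 'b" assume "f \<in> vanishing_morrey_space p lam"
  then have f: "f \<in> morrey_space p lam" by (simp add: vanishing_morrey_space_def)
  then have fm: "f \<in> borel_measurable lebesgue" using p by (simp add: morrey_space_iff)
  show "AE x in lebesgue. maximal_function f x < \<infinity>" by (rule AE_maximal_function_finite[OF p lam(2) f])
  have "maximal_function f \<in> borel_measurable borel"
    by (rule borel_measurable_maximal_function[OF fm])
  then show "(\<lambda>x. enn2real (maximal_function f x)) \<in> borel_measurable lebesgue"
    by (intro measurable_completion) measurable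
  show "ball_mass (\<lambda>y. ennreal (norm (enn2real (maximal_function f y)) powr p)) x r
     \<le> ennreal (1 powr p * maximal_const p DIM('a)) *
       (\<Sum>k. ennreal ((1 / 2 ^ DIM('a)) ^ k) * ball_mass (\<lambda>y. ennreal (norm (f y) powr p)) (1 *\<^sub>R x) (2 ^ k * r))"
    if "0 < r" for x r
    using maximal_dominated_sum[OF p fm that, of 1 "\<lambda>y. enn2real (maximal_function f y)" x]
    by (simp add: ennreal_enn2real_le)
qed (use p lam maximal_const_nonneg dyadic_ratio_less_1 in auto)

section \<open>The sharp maximal function\<close>

lemma nn_integral_norm_indicator_scaleR:
  "(\<integral>\<^sup>+ y. ennreal (norm (indicat_real A y *\<^sub>R f y)) \<partial>M) = (\<integral>\<^sup>+ y\<in>A. ennreal (norm (f y)) \<partial>M)"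
  by (intro nn_integral_cong) (auto simp: indicator_def)

text \<open>Balls have finite measure and a number \<open>t \<ge> 0\<close> is at most
  \<open>1 + t powr p\<close>.\<close>

lemma locally_p_integrable_imp_integrable_ball:
  fixes f :: "'a::euclidean_space \<Rightarrow> 'b::{banach, second_countable_topology}"
  assumes p: "1 \<le> p" and f: "locally_p_integrable p f"
  shows "set_integrable lebesgue (ball x r) f"
proof -
  have [measurable]: "f \<in> borel_measurable lebesgue" using f by (simp add: locally_p_integrable_def)
  have "set_integrable lebesgue (cball x r) (\<lambda>y. norm (f y) powr p)"
    using f by (simp add: locally_p_integrable_def)
  then have "set_integrable lebesgue (ball x r) (\<lambda>y. norm (f y) powr p)"
    by (rule set_integrable_subset) auto
  moreover have "set_integrable lebesgue (ball x r) (\<lambda>y. 1 :: real)"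
    unfolding set_integrable_def using emeasure_lborel_ball_finite[of x r] by simp
  ultimately have "set_integrable lebesgue (ball x r) (\<lambda>y. 1 + norm (f y) powr p)"
    by (rule set_integral_add(1)[rotated])
  then have int: "integrable lebesgue (\<lambda>y. indicator (ball x r) y *\<^sub>R (1 + norm (f y) powr p))"
    by (simp add: set_integrable_def)
  have le: "norm (f y) \<le> 1 + norm (f y) powr p" for y
  proof (cases "norm (f y) \<le> 1")
    case False
    then have "norm (f y) powr 1 \<le> norm (f y) powr p" using p by (intro powr_mono) auto
    then show ?thesis using False by simp
  qed (simp add: add_increasing2)
  show ?thesis
    unfolding set_integrable_def
  proof (rule Bochner_Integration.integrable_bound[OF int])
    show "(\<lambda>y. indicat_real (ball x r) y *\<^sub>R f y) \<in> borel_measurable lebesgue" by measurable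
  qed (use le in \<open>auto simp: indicator_def\<close>)
qed

lemma morrey_space_integrable_ball:
  fixes f :: "'a::euclidean_space \<Rightarrow> 'b::{banach, second_countable_topology}"
  assumes "1 \<le> p" and "f \<in> morrey_space p lam"
  shows "set_integrable lebesgue (ball x r) f"
  using assms by (intro locally_p_integrable_imp_integrable_ball[of p]) (auto simp: morrey_space_def)

section \<open>Measurability of the sharp maximal function\<close>

text \<open>Dominated convergence along a sequence of centres: all moving balls lie in one fixed
  ball around the origin.\<close>

lemma isCont_ball_integral:
  fixes \<phi> :: "'a::euclidean_space \<Rightarrow> 'b::{banach, second_countable_topology}"
  assumes int: "\<And>R. set_integrable lebesgue (ball 0 R) \<phi>"
  shows "isCont (\<lambda>x. LINT y:ball x t|lebesgue. \<phi> y) a"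
  unfolding continuous_at_sequentially
proof (intro allI impI)
  fix u assume u: "u \<longlonglongrightarrow> a"
  then obtain B where B: "\<And>n. norm (u n) \<le> B" using Bseq_def convergent_imp_Bseq convergentI by metis
  have "norm a \<le> B" using u B by (intro LIMSEQ_le_const2[OF tendsto_norm]) auto
  have far: "norm y < B + t" if "dist z y < t" "norm z \<le> B" for y z
    using that norm_triangle_ineq2[of y z] by (simp add: dist_norm norm_minus_commute)
  have meas: "(\<lambda>y. indicat_real (ball z t) y *\<^sub>R \<phi> y) \<in> borel_measurable lebesgue" if "norm z \<le> B" for z
  proof -
    have [measurable]: "(\<lambda>y. indicat_real (ball 0 (B + t)) y *\<^sub>R \<phi> y) \<in> borel_measurable lebesgue"
      using int[of "B + t"] unfolding set_integrable_def by (rule borel_measurable_integrable)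
    have "(\<lambda>y. indicat_real (ball z t) y *\<^sub>R \<phi> y)
      = (\<lambda>y. indicat_real (ball z t) y *\<^sub>R (indicat_real (ball 0 (B + t)) y *\<^sub>R \<phi> y))"
      using far[OF _ that] by (auto simp: indicator_def fun_eq_iff)
    then show ?thesis by (simp only:) measurable
  qed
  have "(\<lambda>n. LINT y:ball (u n) t|lebesgue. \<phi> y) \<longlonglongrightarrow> (LINT y:ball a t|lebesgue. \<phi> y)"
    unfolding set_lebesgue_integral_def
  proof (rule integral_dominated_convergence)
    show "integrable lebesgue (\<lambda>y. norm (indicat_real (ball 0 (B + t)) y *\<^sub>R \<phi> y))"
      using int[of "B + t"] unfolding set_integrable_def by (rule integrable_norm)
    show "AE y in lebesgue. norm (indicat_real (ball (u n) t) y *\<^sub>R \<phi> y)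
      \<le> norm (indicat_real (ball 0 (B + t)) y *\<^sub>R \<phi> y)" for n
      using far[OF _ B[of n]] by (auto simp: indicator_def)
    \<comment> \<open>Off the bounding sphere, a null set, the indicators of the moving balls are
      eventually equal to that of the limit ball.\<close>
    have "AE y in lebesgue. y \<notin> sphere a t"
      using negligible_sphere[of a t] by (intro AE_not_in) (simp add: negligible_iff_null_sets)
    then show "AE y in lebesgue. (\<lambda>n. indicat_real (ball (u n) t) y *\<^sub>R \<phi> y)
        \<longlonglongrightarrow> indicat_real (ball a t) y *\<^sub>R \<phi> y"
    proof eventually_elim
      case (elim y)
      have lim: "(\<lambda>n. dist (u n) y) \<longlonglongrightarrow> dist a y" using u by (intro tendsto_intros)
      have "\<forall>\<^sub>F n in sequentially. indicat_real (ball (u n) t) y = indicat_real (ball a t) y"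
      proof (cases "dist a y < t")
        case True
        then show ?thesis using order_tendstoD(2)[OF lim True] by (auto elim!: eventually_mono simp: indicator_def)
      next
        case False
        then have "t < dist a y" using elim by simp
        then show ?thesis using order_tendstoD(1)[OF lim, of t] by (auto elim!: eventually_mono simp: indicator_def)
      qed
      then show ?case by (intro tendsto_eventually) (auto elim: eventually_mono)
    qed
  qed (use meas B \<open>norm a \<le> B\<close> in auto)
  then show "((\<lambda>x. LINT y:ball x t|lebesgue. \<phi> y) \<circ> u) \<longlonglongrightarrow> (LINT y:ball a t|lebesgue. \<phi> y)"
    by (simp add: o_def)
qed

text \<open>The centre and the average move together. With the average frozen at \<open>a\<close>
  the previous continuity applies; unfreezing it changes the integral by at most the volume times
  the change of the average, which tends to 0.\<close>

lemma isCont_ball_oscillation: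
  fixes f :: "'a::euclidean_space \<Rightarrow> 'b::{banach, second_countable_topology}"
  assumes int: "\<And>x r. set_integrable lebesgue (ball x r) f"
  shows "isCont (\<lambda>x. LINT y:ball x t|lebesgue. norm (f y - ball_average f x t)) a"
proof (cases "0 < t")
  case t: True
  let ?m = "\<lambda>x. ball_average f x t"
  have const: "set_integrable lebesgue (ball x r) (\<lambda>y. c)" for x :: 'a and r and c :: 'b
    unfolding set_integrable_def using emeasure_lborel_ball_finite[of x r] by simp
  have osc: "set_integrable lebesgue (ball x r) (\<lambda>y. norm (f y - c))" for x r c
    by (intro set_integrable_norm set_integral_diff(1) int const)
  define w where "w = t ^ DIM('a) * measure lebesgue (ball (0::'a) 1)"
  have vol: "measure lebesgue (ball x t) = w" for x :: 'a
    using content_ball_conv_unit_ball[of t x] t by (simp add: w_def)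
  have m: "(?m \<longlongrightarrow> ?m a) (at a)"
    unfolding ball_average_def vol
    using isCont_ball_integral[where t=t and a=a, OF int] unfolding isCont_def by (intro tendsto_intros)
  have V: "((\<lambda>x. LINT y:ball x t|lebesgue. norm (f y - ?m a)) \<longlongrightarrow> (LINT y:ball a t|lebesgue. norm (f y - ?m a))) (at a)"
    using isCont_ball_integral[where t=t and a=a, OF osc[where c="?m a"]] by (simp add: isCont_def)
  have "((\<lambda>x. (LINT y:ball x t|lebesgue. norm (f y - ?m x)) - (LINT y:ball x t|lebesgue. norm (f y - ?m a))) \<longlongrightarrow> 0) (at a)"
  proof (rule Lim_null_comparison)
    show "((\<lambda>x. w * norm (?m x - ?m a)) \<longlongrightarrow> 0) (at a)"
      using m by (intro tendsto_mult_right_zero) (simp add: LIM_zero_iff tendsto_norm_zero_iff)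
    show "\<forall>\<^sub>F x in at a. norm ((LINT y:ball x t|lebesgue. norm (f y - ?m x)) - (LINT y:ball x t|lebesgue. norm (f y - ?m a)))
      \<le> w * norm (?m x - ?m a)"
    proof (intro always_eventually allI)
      fix x
      have "(LINT y:ball x t|lebesgue. norm (f y - ?m x)) - (LINT y:ball x t|lebesgue. norm (f y - ?m a))
        = (LINT y:ball x t|lebesgue. norm (f y - ?m x) - norm (f y - ?m a))"
        by (rule set_integral_diff(2)[symmetric]) (rule osc)+
      also have "norm \<dots> \<le> (LINT y:ball x t|lebesgue. norm (?m x - ?m a))"
        unfolding set_lebesgue_integral_def
      proof (rule Bochner_Integration.integral_norm_bound_integral)
        show "integrable lebesgue (\<lambda>y. indicat_real (ball x t) y *\<^sub>R (norm (f y - ?m x) - norm (f y - ?m a)))"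
          using set_integral_diff(1)[OF osc osc] unfolding set_integrable_def .
        show "integrable lebesgue (\<lambda>y. indicat_real (ball x t) y *\<^sub>R norm (?m x - ?m a))"
          using emeasure_lborel_ball_finite[of x t] by simp
        fix y
        have "\<bar>norm (f y - ?m x) - norm (f y - ?m a)\<bar> \<le> norm ((f y - ?m x) - (f y - ?m a))"
          by (rule norm_triangle_ineq3)
        also have "\<dots> = norm (?m x - ?m a)" by (simp add: norm_minus_commute)
        finally show "norm (indicat_real (ball x t) y *\<^sub>R (norm (f y - ?m x) - norm (f y - ?m a)))
          \<le> indicat_real (ball x t) y *\<^sub>R norm (?m x - ?m a)"
          by (simp add: indicator_def)
      qed
      also have "\<dots> = measure lebesgue (ball x t) * norm (?m x - ?m a)"
        unfolding set_lebesgue_integral_def using emeasure_lborel_ball_finite[of x t] by simp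
      finally show "norm ((LINT y:ball x t|lebesgue. norm (f y - ?m x)) - (LINT y:ball x t|lebesgue. norm (f y - ?m a)))
        \<le> w * norm (?m x - ?m a)"
        by (simp only: vol)
    qed
  qed
  from tendsto_add[OF this V] show ?thesis by (simp add: isCont_def)
qed (simp add: ball_empty set_lebesgue_integral_def)

text \<open>The integrand changes with the ball, so the monotonicity argument for \<open>M\<close>
  does not carry over. Continuity in the centre for each fixed radius takes its place and again
  makes the superlevel sets open.\<close>

lemma borel_measurable_sharp_maximal_function:
  fixes f :: "'a::euclidean_space \<Rightarrow> 'b::{banach, second_countable_topology}"
  assumes int: "\<And>x r. set_integrable lebesgue (ball x r) f"
  shows "sharp_maximal_function f \<in> borel_measurable borel"
proof (rule borel_measurableI_greater)
  fix c
  let ?U = "\<lambda>t x. LINT y:ball x t|lebesgue. norm (f y - ball_average f x t)"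
  let ?v = "\<lambda>t. ennreal (t ^ DIM('a) * measure lebesgue (ball (0::'a) 1))"
  have U: "(\<integral>\<^sup>+ y\<in>ball x t. ennreal (norm (f y - ball_average f x t)) \<partial>lebesgue) = ennreal (?U t x)" for x t
  proof -
    have "set_integrable lebesgue (ball x t) (\<lambda>y. ball_average f x t)"
      unfolding set_integrable_def using emeasure_lborel_ball_finite[of x t] by simp
    then have "set_integrable lebesgue (ball x t) (\<lambda>y. norm (f y - ball_average f x t))"
      by (intro set_integrable_norm set_integral_diff(1) int)
    then have "integrable lebesgue (\<lambda>y. indicat_real (ball x t) y *\<^sub>R norm (f y - ball_average f x t))"
      unfolding set_integrable_def .
    then have "(\<integral>\<^sup>+ y. ennreal (indicat_real (ball x t) y *\<^sub>R norm (f y - ball_average f x t)) \<partial>lebesgue) = ennreal (?U t x)"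
      unfolding set_lebesgue_integral_def by (rule nn_integral_eq_integral) auto
    moreover have "(\<integral>\<^sup>+ y\<in>ball x t. ennreal (norm (f y - ball_average f x t)) \<partial>lebesgue)
      = (\<integral>\<^sup>+ y. ennreal (indicat_real (ball x t) y *\<^sub>R norm (f y - ball_average f x t)) \<partial>lebesgue)"
      by (intro nn_integral_cong) (auto simp: indicator_def)
    ultimately show ?thesis by simp
  qed
  have "c < sharp_maximal_function f x \<longleftrightarrow> (\<exists>t\<in>{0<..}. c * ?v t < ennreal (?U t x))" for x
    unfolding sharp_maximal_function_def less_SUP_iff U
  proof (rule bex_cong[OF refl])
    fix t :: real assume "t \<in> {0<..}"
    then have t: "0 < t" by simp
    show "c < ennreal (?U t x) / emeasure lebesgue (ball x t) \<longleftrightarrow> c * ?v t < ennreal (?U t x)"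
      unfolding emeasure_lebesgue_ball[OF less_imp_le[OF t]]
      using t measure_lebesgue_unit_ball_pos[where 'a='a] by (intro ennreal_less_divide_iff) simp
  qed
  then have "{x \<in> space borel. c < sharp_maximal_function f x} = (\<Union>t\<in>{0<..}. {x. c * ?v t < ennreal (?U t x)})"
    by auto
  also have "open \<dots>"
    using isCont_ball_oscillation[OF int]
    by (intro open_UN ballI open_Collect_less continuous_on_const continuous_on_ennreal continuous_at_imp_continuous_on) auto
  finally show "{x \<in> space borel. c < sharp_maximal_function f x} \<in> sets borel" by (rule borel_open)
qed

lemma sharp_maximal_function_le:
  fixes f :: "'a::euclidean_space \<Rightarrow> 'b::{banach, second_countable_topology}"
  assumes [measurable]: "f \<in> borel_measurable lebesgue"
  shows "sharp_maximal_function f x \<le> 2 * maximal_function f x"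
  unfolding sharp_maximal_function_def
proof (rule SUP_least)
  fix t :: real assume "t \<in> {0<..}"
  then have t: "0 < t" by simp
  define v where "v = t ^ DIM('a) * measure lebesgue (ball (0::'a) 1)"
  have v: "0 < v" using t measure_lebesgue_unit_ball_pos[where 'a='a] by (simp add: v_def)
  have B: "emeasure lebesgue (ball x t) = ennreal v"
    unfolding v_def using t by (intro emeasure_lebesgue_ball) simp
  let ?m = "ball_average f x t" and ?I = "\<integral>\<^sup>+ y\<in>ball x t. ennreal (norm (f y)) \<partial>lebesgue"
  have "ennreal (norm (LINT z:ball x t|lebesgue. f z)) \<le> ?I"
  proof (cases "set_integrable lebesgue (ball x t) f")
    case True
    then have "ennreal (norm (LINT z:ball x t|lebesgue. f z)) \<le> (\<integral>\<^sup>+ y. ennreal (norm (indicat_real (ball x t) y *\<^sub>R f y)) \<partial>lebesgue)"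
      unfolding set_lebesgue_integral_def set_integrable_def by (rule integral_norm_bound_ennreal)
    then show ?thesis unfolding nn_integral_norm_indicator_scaleR .
  next
    case False
    \<comment> \<open>Without integrability the integral of \<open>f\<close> has the default value
      0, and the bound is trivial.\<close>
    then show ?thesis by (simp add: set_lebesgue_integral_def set_integrable_def not_integrable_integral_eq)
  qed
  moreover have "measure lebesgue (ball x t) = v"
    using B v by (simp add: measure_def del: emeasure_completion measure_completion)
  then have "norm ?m * v = norm (LINT z:ball x t|lebesgue. f z)"
    using v unfolding ball_average_def by (simp del: measure_completion)
  ultimately have m: "ennreal (norm ?m) * ennreal v \<le> ?I" using v by (simp flip: ennreal_mult)
  have "(\<integral>\<^sup>+ y\<in>ball x t. ennreal (norm (f y - ?m)) \<partial>lebesgue)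
    \<le> (\<integral>\<^sup>+ y. ennreal (norm (f y)) * indicator (ball x t) y + ennreal (norm ?m) * indicator (ball x t) y \<partial>lebesgue)"
    by (intro nn_integral_mono)
       (auto simp: indicator_def norm_triangle_ineq4 simp flip: ennreal_plus intro!: ennreal_leI)
  also have "\<dots> = ?I + ennreal (norm ?m) * emeasure lebesgue (ball x t)"
    by (subst nn_integral_add) (auto simp: nn_integral_cmult)
  also have "\<dots> \<le> ?I + ?I" unfolding B by (intro add_left_mono m)
  also have "\<dots> = 2 * ?I" by (simp add: mult_2)
  finally have "(\<integral>\<^sup>+ y\<in>ball x t. ennreal (norm (f y - ?m)) \<partial>lebesgue) / emeasure lebesgue (ball x t)
    \<le> 2 * ?I / emeasure lebesgue (ball x t)"
    by (rule divide_right_mono_ennreal)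
  also have "\<dots> = 2 * (?I / emeasure lebesgue (ball x t))" by (simp add: ennreal_times_divide)
  also have "\<dots> \<le> 2 * maximal_function f x"
    unfolding maximal_function_def using t by (intro mult_left_mono SUP_upper) auto
  finally show "(\<integral>\<^sup>+ y\<in>ball x t. ennreal (norm (f y - ?m)) \<partial>lebesgue) / emeasure lebesgue (ball x t)
    \<le> 2 * maximal_function f x" .
qed

lemma sharp_maximal_function_bounded:
  fixes p lam :: real
  assumes p: "1 < p" and lam: "0 \<le> lam" "lam < real DIM('a::euclidean_space)"
  shows "bounded_in_vanishing_morrey p lam
    (\<lambda>(f :: 'a \<Rightarrow> 'b::{banach, second_countable_topology}) x. sharp_maximal_function f x < \<infinity>)
    (\<lambda>f x. enn2real (sharp_maximal_function f x))"
proof (rule bounded_in_vanishing_morrey_dominated[OF _ _ _ _ _ _ bounded_in_vanishing_morrey_id, where C="2 powr p * maximal_const p DIM('a)" and b="1 / 2 ^ DIM('a)" and c="\<lambda>_. 1"])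
  fix f :: "'a \<Rightarrow> 'b" assume "f \<in> vanishing_morrey_space p lam"
  then have f: "f \<in> morrey_space p lam" by (simp add: vanishing_morrey_space_def)
  then have fm: "f \<in> borel_measurable lebesgue" using p by (simp add: morrey_space_iff)
  note le = sharp_maximal_function_le[OF fm]
  show "AE x in lebesgue. sharp_maximal_function f x < \<infinity>"
    using AE_maximal_function_finite[OF p lam(2) f]
  proof eventually_elim
    case (elim x)
    then have "2 * maximal_function f x < \<infinity>" by (simp add: ennreal_mult_less_top)
    then show ?case using le by (rule order_le_less_trans[rotated])
  qed
  have "sharp_maximal_function f \<in> borel_measurable borel"
    using f p by (intro borel_measurable_sharp_maximal_function morrey_space_integrable_ball) auto
  then show "(\<lambda>x. enn2real (sharp_maximal_function f x)) \<in> borel_measurable lebesgue"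
    by (intro measurable_completion) measurable
  show "ball_mass (\<lambda>y. ennreal (norm (enn2real (sharp_maximal_function f y)) powr p)) x r
     \<le> ennreal (2 powr p * maximal_const p DIM('a)) *
       (\<Sum>k. ennreal ((1 / 2 ^ DIM('a)) ^ k) * ball_mass (\<lambda>y. ennreal (norm (f y) powr p)) (1 *\<^sub>R x) (2 ^ k * r))"
    if "0 < r" for x r
    using maximal_dominated_sum[OF p fm that, of 2 "\<lambda>y. enn2real (sharp_maximal_function f y)" x]
      order_trans[OF ennreal_enn2real_le le] by simp
qed (use p lam maximal_const_nonneg dyadic_ratio_less_1 in auto)

section \<open>The Hardy operators\<close>

text \<open>The radius is doubled so that one function serves both operators: it majorises
  \<open>H f\<close>, and its dilates majorise the integrals over the dyadic annuli of the dual
  operator.\<close>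

definition hardy_average :: "('a::euclidean_space \<Rightarrow> 'b::{banach, second_countable_topology}) \<Rightarrow> 'a \<Rightarrow> real" where
  "hardy_average f z = (1 / norm z ^ DIM('a)) * (LINT y:ball 0 (2 * norm z)|lebesgue. norm (f y))"

lemma hardy_average_nonneg: "0 \<le> hardy_average f z"
  unfolding hardy_average_def set_lebesgue_integral_def
  by (intro mult_nonneg_nonneg integral_nonneg_AE) auto

lemma ball_mass_norm_eq_integral:
  fixes f :: "'a::euclidean_space \<Rightarrow> 'b::{banach, second_countable_topology}"
  assumes int: "set_integrable lebesgue (ball x r) f"
  shows "ball_mass (\<lambda>y. ennreal (norm (f y))) x r = ennreal (LINT y:ball x r|lebesgue. norm (f y))"
proof -
  have "integrable lebesgue (\<lambda>y. indicat_real (ball x r) y *\<^sub>R norm (f y))"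
    using set_integrable_norm[OF int] unfolding set_integrable_def .
  then have "(\<integral>\<^sup>+ y. ennreal (indicat_real (ball x r) y *\<^sub>R norm (f y)) \<partial>lebesgue)
    = ennreal (LINT y:ball x r|lebesgue. norm (f y))"
    unfolding set_lebesgue_integral_def by (rule nn_integral_eq_integral) auto
  moreover have "ball_mass (\<lambda>y. ennreal (norm (f y))) x r
    = (\<integral>\<^sup>+ y. ennreal (indicat_real (ball x r) y *\<^sub>R norm (f y)) \<partial>lebesgue)"
    unfolding ball_mass_def by (intro nn_integral_cong) (auto simp: indicator_def)
  ultimately show ?thesis by simp
qed

text \<open>The ball of radius \<open>2 * norm z\<close> around 0 lies in the ball of radius
  \<open>3 * norm z\<close> around \<open>z\<close>, hence the factor \<open>3 ^ DIM('a)\<close>;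
  the unit ball volume comes from normalising by \<open>norm z ^ DIM('a)\<close> only.\<close>

lemma hardy_average_le_maximal_function:
  fixes f :: "'a::euclidean_space \<Rightarrow> 'b::{banach, second_countable_topology}"
  assumes int: "\<And>x r. set_integrable lebesgue (ball x r) f"
  shows "ennreal (hardy_average f z)
    \<le> ennreal (3 ^ DIM('a) * measure lebesgue (ball (0::'a) 1)) * maximal_function f z"
proof (cases "z = 0")
  case False
  let ?v = "measure lebesgue (ball (0::'a) 1)" and ?n = "DIM('a)" and ?F = "\<lambda>y. ennreal (norm (f y))"
  define \<rho> where "\<rho> = norm z"
  have \<rho>: "0 < \<rho>" using False by (simp add: \<rho>_def)
  have v: "0 < ?v" by (rule measure_lebesgue_unit_ball_pos)
  define L where "L = (LINT y:ball 0 (2 * \<rho>)|lebesgue. norm (f y))"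
  have L0: "0 \<le> L" unfolding L_def set_lebesgue_integral_def by (intro integral_nonneg_AE) auto
  have "ball 0 (2 * \<rho>) \<subseteq> ball z (3 * \<rho>)"
  proof
    fix y :: 'a assume "y \<in> ball 0 (2 * \<rho>)"
    then show "y \<in> ball z (3 * \<rho>)" using norm_triangle_ineq4[of z y] by (simp add: dist_norm \<rho>_def)
  qed
  then have "ball_mass ?F 0 (2 * \<rho>) \<le> ball_mass ?F z (3 * \<rho>)"
    unfolding ball_mass_def by (intro nn_integral_mono mult_left_mono) (auto simp: indicator_def)
  then have L: "ennreal L \<le> ball_mass ?F z (3 * \<rho>)"
    unfolding L_def by (simp only: ball_mass_norm_eq_integral[OF int])
  have "hardy_average f z = 3 ^ ?n * ?v * (L / ((3 * \<rho>) ^ ?n * ?v))"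
    using \<rho> v by (simp add: hardy_average_def L_def \<rho>_def power_mult_distrib del: measure_completion)
  then have "ennreal (hardy_average f z) = ennreal (3 ^ ?n * ?v) * (ennreal L / ennreal ((3 * \<rho>) ^ ?n * ?v))"
    using \<rho> v L0 by (simp add: divide_ennreal flip: ennreal_mult del: measure_completion)
  also have "ennreal ((3 * \<rho>) ^ ?n * ?v) = emeasure lebesgue (ball z (3 * \<rho>))"
    using \<rho> by (intro emeasure_lebesgue_ball[symmetric]) simp
  also have "ennreal L / emeasure lebesgue (ball z (3 * \<rho>)) \<le> ball_mass ?F z (3 * \<rho>) / emeasure lebesgue (ball z (3 * \<rho>))"
    by (rule divide_right_mono_ennreal[OF L])
  also have "\<dots> \<le> maximal_function f z"
    unfolding maximal_function_eq_hl_maximal hl_maximal_def using \<rho> by (intro SUP_upper) auto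
  finally show ?thesis by (simp add: mult_left_mono)
qed (simp add: hardy_average_def set_lebesgue_integral_def)

text \<open>Measurability of a parameter integral over a sigma-finite measure: Borel in the
  parameter \<open>x\<close>, Lebesgue in \<open>y\<close>. The name \<open>N\<close> keeps the norm
  as a Lebesgue measurable function of \<open>y\<close> apart from the parameter.\<close>

lemma borel_measurable_integral_norm_less:
  fixes f :: "'a::euclidean_space \<Rightarrow> 'b::{banach, second_countable_topology}"
  assumes [measurable]: "f \<in> borel_measurable lebesgue" "u \<in> borel_measurable borel"
  shows "(\<lambda>x::'a. LINT y:{y. norm y < u x}|lebesgue. f y) \<in> borel_measurable borel"
    and "(\<lambda>x::'a. LINT y:{y. u x < norm y}|lebesgue. f y) \<in> borel_measurable borel"
proof -
  interpret leb: sigma_finite_measure "lebesgue :: 'a measure" by (rule sigma_finite_lebesgue)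
  define N :: "'a \<Rightarrow> real" where "N = norm"
  have [measurable]: "N \<in> borel_measurable lebesgue"
    unfolding N_def by (intro measurable_completion) measurable
  have "(\<lambda>x::'a. LINT y|lebesgue. (if N y < u x then 1 else 0) *\<^sub>R f y) \<in> borel_measurable borel"
    "(\<lambda>x::'a. LINT y|lebesgue. (if u x < N y then 1 else 0) *\<^sub>R f y) \<in> borel_measurable borel"
    by measurable
  then show "(\<lambda>x::'a. LINT y:{y. norm y < u x}|lebesgue. f y) \<in> borel_measurable borel"
    "(\<lambda>x::'a. LINT y:{y. u x < norm y}|lebesgue. f y) \<in> borel_measurable borel"
    unfolding set_lebesgue_integral_def indicator_def of_bool_def N_def by simp_all
qed

lemma borel_measurable_hardy_average:
  fixes f :: "'a::euclidean_space \<Rightarrow> 'b::{banach, second_countable_topology}"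
  assumes [measurable]: "f \<in> borel_measurable lebesgue"
  shows "hardy_average f \<in> borel_measurable borel"
proof -
  have "ball (0::'a) (2 * norm z) = {y. norm y < 2 * norm z}" for z :: 'a by auto
  moreover have [measurable]: "(\<lambda>z::'a. LINT y:{y. norm y < 2 * norm z}|lebesgue. norm (f y)) \<in> borel_measurable borel"
    by (intro borel_measurable_integral_norm_less) measurable
  ultimately show ?thesis unfolding hardy_average_def[abs_def] by (simp only:) measurable
qed

lemma hardy_dominated_sum:
  fixes f :: "'a::euclidean_space \<Rightarrow> 'b::{banach, second_countable_topology}" and h :: "'a \<Rightarrow> real"
  assumes p: "1 < p" and f: "f \<in> morrey_space p lam" and r: "0 < r"
    and h: "\<And>y. 0 \<le> h y" "\<And>y. h y \<le> hardy_average f y"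
  shows "ball_mass (\<lambda>y. ennreal (h y powr p)) x r
    \<le> ennreal ((3 ^ DIM('a) * measure lebesgue (ball (0::'a) 1)) powr p * maximal_const p DIM('a))
      * (\<Sum>k. ennreal ((1 / 2 ^ DIM('a)) ^ k) * ball_mass (\<lambda>y. ennreal (norm (f y) powr p)) (1 *\<^sub>R x) (2 ^ k * r))"
proof -
  have "f \<in> borel_measurable lebesgue" using f p by (simp add: morrey_space_iff)
  moreover have "ennreal (h y) \<le> ennreal (3 ^ DIM('a) * measure lebesgue (ball (0::'a) 1)) * maximal_function f y" for y
    using ennreal_leI[OF h(2)] hardy_average_le_maximal_function[OF morrey_space_integrable_ball[OF _ f]] p
    by (meson less_imp_le order_trans)
  ultimately show ?thesis
    using maximal_dominated_sum[OF p _ r, of f "3 ^ DIM('a) * measure lebesgue (ball (0::'a) 1)" h x] h(1)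
    by simp
qed

lemma hardy_average_bounded:
  fixes p lam :: real
  assumes p: "1 < p" and lam: "0 \<le> lam" "lam < real DIM('a::euclidean_space)"
  shows "bounded_in_vanishing_morrey p lam (\<lambda>_ _. True)
    (hardy_average :: ('a \<Rightarrow> 'b::{banach, second_countable_topology}) \<Rightarrow> 'a \<Rightarrow> real)"
proof (rule bounded_in_vanishing_morrey_dominated[OF _ _ _ _ _ _ bounded_in_vanishing_morrey_id,
      where C="(3 ^ DIM('a) * measure lebesgue (ball (0::'a) 1)) powr p * maximal_const p DIM('a)"
        and b="1 / 2 ^ DIM('a)" and c="\<lambda>_. 1"])
  fix f :: "'a \<Rightarrow> 'b" assume "f \<in> vanishing_morrey_space p lam"
  then have f: "f \<in> morrey_space p lam" by (simp add: vanishing_morrey_space_def)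
  then have "f \<in> borel_measurable lebesgue" using p by (simp add: morrey_space_iff)
  then show "hardy_average f \<in> borel_measurable lebesgue"
    by (intro measurable_completion) (simp add: borel_measurable_hardy_average)
  show "ball_mass (\<lambda>y. ennreal (norm (hardy_average f y) powr p)) x r
    \<le> ennreal ((3 ^ DIM('a) * measure lebesgue (ball (0::'a) 1)) powr p * maximal_const p DIM('a))
      * (\<Sum>k. ennreal ((1 / 2 ^ DIM('a)) ^ k) * ball_mass (\<lambda>y. ennreal (norm (f y) powr p)) (1 *\<^sub>R x) (2 ^ k * r))"
    if "0 < r" for x r
    using hardy_average_nonneg[of f] by (intro hardy_dominated_sum[OF p f that]) auto
qed (use p lam maximal_const_nonneg dyadic_ratio_less_1 in auto)

lemma norm_hardy_op_le:
  fixes f :: "'a::euclidean_space \<Rightarrow> 'b::{banach, second_countable_topology}"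
  assumes int: "\<And>x r. set_integrable lebesgue (ball x r) f"
  shows "norm (hardy_op f x) \<le> hardy_average f x"
proof -
  have ball: "{y. norm y < norm x} = ball (0::'a) (norm x)" by auto
  have "norm (LINT y:{y. norm y < norm x}|lebesgue. f y) \<le> (LINT y:ball 0 (2 * norm x)|lebesgue. norm (f y))"
    unfolding set_lebesgue_integral_def ball
  proof (rule Bochner_Integration.integral_norm_bound_integral)
    show "integrable lebesgue (\<lambda>y. indicat_real (ball 0 (norm x)) y *\<^sub>R f y)"
      using int unfolding set_integrable_def .
    show "integrable lebesgue (\<lambda>y. indicat_real (ball 0 (2 * norm x)) y *\<^sub>R norm (f y))"
      using set_integrable_norm[OF int] unfolding set_integrable_def .
    show "norm (indicat_real (ball 0 (norm x)) y *\<^sub>R f y) \<le> indicat_real (ball 0 (2 * norm x)) y *\<^sub>R norm (f y)" for y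
    proof -
      have "norm y < norm x \<Longrightarrow> norm y < 2 * norm x" using norm_ge_zero[of x] by linarith
      then show ?thesis by (auto simp: indicator_def)
    qed
  qed
  then show ?thesis unfolding hardy_op_def hardy_average_def
    by (auto intro!: mult_left_mono divide_right_mono simp: ball)
qed

lemma hardy_op_bounded:
  fixes p lam :: real
  assumes p: "1 < p" and lam: "0 \<le> lam" "lam < real DIM('a::euclidean_space)"
  shows "bounded_in_vanishing_morrey p lam
    (\<lambda>(f :: 'a \<Rightarrow> 'b::{banach, second_countable_topology}) x. set_integrable lebesgue {y. norm y < norm x} f)
    hardy_op"
proof (rule bounded_in_vanishing_morrey_dominated[OF _ _ _ _ _ _ bounded_in_vanishing_morrey_id,
      where C="(3 ^ DIM('a) * measure lebesgue (ball (0::'a) 1)) powr p * maximal_const p DIM('a)"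
        and b="1 / 2 ^ DIM('a)" and c="\<lambda>_. 1"])
  fix f :: "'a \<Rightarrow> 'b" assume "f \<in> vanishing_morrey_space p lam"
  then have f: "f \<in> morrey_space p lam" by (simp add: vanishing_morrey_space_def)
  then have fm [measurable]: "f \<in> borel_measurable lebesgue" using p by (simp add: morrey_space_iff)
  have int: "set_integrable lebesgue (ball x r) f" for x r
    using p f by (intro morrey_space_integrable_ball) auto
  have ball: "{y. norm y < norm x} = ball (0::'a) (norm x)" for x :: 'a by auto
  show "AE x in (lebesgue :: 'a measure). set_integrable lebesgue {y. norm y < norm x} f"
    unfolding ball using int by simp
  have [measurable]: "(\<lambda>x::'a. LINT y:{y. norm y < norm x}|lebesgue. f y) \<in> borel_measurable borel"
    by (intro borel_measurable_integral_norm_less) measurable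
  have "hardy_op f \<in> borel_measurable borel" unfolding hardy_op_def[abs_def] by measurable
  then show "hardy_op f \<in> borel_measurable lebesgue" by (intro measurable_completion) simp
  show "ball_mass (\<lambda>y. ennreal (norm (hardy_op f y) powr p)) x r
    \<le> ennreal ((3 ^ DIM('a) * measure lebesgue (ball (0::'a) 1)) powr p * maximal_const p DIM('a))
      * (\<Sum>k. ennreal ((1 / 2 ^ DIM('a)) ^ k) * ball_mass (\<lambda>y. ennreal (norm (f y) powr p)) (1 *\<^sub>R x) (2 ^ k * r))"
    if "0 < r" for x r
    by (intro hardy_dominated_sum[OF p f that] norm_hardy_op_le[OF int]) auto
qed (use p lam maximal_const_nonneg dyadic_ratio_less_1 in auto)

section \<open>The dual Hardy operator\<close>

text \<open>Linear change of variables. It is carried out for \<open>lborel\<close>, with which the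
  Lebesgue integral agrees, and therefore \<open>F\<close> is taken Borel measurable.\<close>

lemma ball_mass_scaleR:
  fixes F :: "'a::euclidean_space \<Rightarrow> ennreal"
  assumes [measurable]: "F \<in> borel_measurable borel" and c: "0 < c"
  shows "ball_mass (\<lambda>y. F (c *\<^sub>R y)) x r = ennreal (1 / c ^ DIM('a)) * ball_mass F (c *\<^sub>R x) (c * r)"
proof -
  note ball_lebesgue_measurable [measurable del]
  have [measurable]: "ball z s \<in> sets borel" for z :: 'a and s by simp
  have ind: "indicator (ball (c *\<^sub>R x) (c * r)) (c *\<^sub>R y) = (indicator (ball x r) y :: ennreal)" for y
  proof -
    have "dist (c *\<^sub>R x) (c *\<^sub>R y) = c * dist x y" using c by (simp add: dist_norm flip: scaleR_diff_right)
    then show ?thesis using c by (simp add: indicator_def)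
  qed
  have "ball_mass F (c *\<^sub>R x) (c * r) = (\<integral>\<^sup>+ y. F y * indicator (ball (c *\<^sub>R x) (c * r)) y \<partial>lborel)"
    unfolding ball_mass_def by (rule nn_integral_completion)
  also have "\<dots> = (\<integral>\<^sup>+ y. F y * indicator (ball (c *\<^sub>R x) (c * r)) y
      \<partial>density (distr lborel borel (\<lambda>y. 0 + c *\<^sub>R y)) (\<lambda>_. \<bar>c\<bar> ^ DIM('a)))"
    using c by (subst lborel_affine[of c 0]) auto
  also have "\<dots> = (\<integral>\<^sup>+ y. ennreal (c ^ DIM('a)) * (F (c *\<^sub>R y) * indicator (ball x r) y) \<partial>lborel)"
    using c by (subst nn_integral_density, measurable, subst nn_integral_distr, measurable)
      (simp add: ind nn_integral_cmult)
  also have "\<dots> = ennreal (c ^ DIM('a)) * (\<integral>\<^sup>+ y. F (c *\<^sub>R y) * indicator (ball x r) y \<partial>lborel)"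
    by (rule nn_integral_cmult) measurable
  also have "(\<integral>\<^sup>+ y. F (c *\<^sub>R y) * indicator (ball x r) y \<partial>lborel) = ball_mass (\<lambda>y. F (c *\<^sub>R y)) x r"
    unfolding ball_mass_def by (rule nn_integral_completion[symmetric])
  finally show ?thesis using c by (simp add: mult.assoc[symmetric] flip: ennreal_mult)
qed

lemma dyadic_scale:
  fixes r d :: real
  assumes r: "0 < r" "r \<le> d"
  obtains k :: nat where "2 ^ k * r \<le> d" "d < 2 ^ Suc k * r"
proof -
  have "\<exists>k::nat. d < 2 ^ k * r" using real_arch_pow[of 2 "d / r"] r by (auto simp: field_simps)
  then have least: "d < 2 ^ (LEAST k. d < 2 ^ k * r) * r" by (rule LeastI_ex)
  show ?thesis
  proof (cases "LEAST k. d < 2 ^ k * r")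
    case 0
    then show ?thesis using least r by simp
  next
    case (Suc k)
    then have "\<not> d < 2 ^ k * r" using not_less_Least[of k "\<lambda>k. d < 2 ^ k * r"] by simp
    then show ?thesis using least Suc that[of k] by simp
  qed
qed

text \<open>On the annulus between the radii \<open>\<rho> k\<close> and \<open>2 * \<rho> k\<close>
  the kernel is at most \<open>1 / \<rho> k ^ n\<close>, and the annulus lies in
  \<open>ball 0 (2 * \<rho> k)\<close>. This is exactly the normalisation of
  \<open>hardy_average\<close> at \<open>2 ^ k x\<close>.\<close>

lemma nn_integral_dual_hardy_le:
  fixes f :: "'a::euclidean_space \<Rightarrow> 'b::{banach, second_countable_topology}"
  assumes [measurable]: "f \<in> borel_measurable lebesgue"
    and int: "\<And>x r. set_integrable lebesgue (ball x r) f" and x: "x \<noteq> 0"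
  shows "(\<integral>\<^sup>+ y. ennreal (norm (indicat_real {y. norm x < norm y} y *\<^sub>R ((1 / norm y ^ DIM('a)) *\<^sub>R f y))) \<partial>lebesgue)
    \<le> (\<Sum>k. ennreal (hardy_average f ((2::real) ^ k *\<^sub>R x)))"
proof -
  let ?n = "DIM('a)"
  define \<rho> where "\<rho> k = 2 ^ k * norm x" for k :: nat
  have \<rho>: "0 < \<rho> k" for k using x by (simp add: \<rho>_def)
  define T where "T k y = ennreal (1 / \<rho> k ^ ?n) * (ennreal (norm (f y)) * indicator (ball 0 (2 * \<rho> k)) y)" for k y
  have T [measurable]: "T k \<in> borel_measurable lebesgue" for k unfolding T_def by measurable
  have "ennreal (norm (indicat_real {y. norm x < norm y} y *\<^sub>R ((1 / norm y ^ ?n) *\<^sub>R f y))) \<le> (\<Sum>k. T k y)" for y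
  proof (cases "norm x < norm y")
    case True
    obtain k where "2 ^ k * norm x \<le> norm y" "norm y < 2 ^ Suc k * norm x"
      by (rule dyadic_scale[OF _ less_imp_le[OF True]]) (use x in simp)
    then have k: "\<rho> k \<le> norm y" "norm y < 2 * \<rho> k" by (simp_all add: \<rho>_def)
    have "\<rho> k ^ ?n \<le> norm y ^ ?n" using k \<rho>[of k] by (intro power_mono) auto
    then have "norm (f y) / norm y ^ ?n \<le> norm (f y) / \<rho> k ^ ?n"
      using \<rho>[of k] order_less_le_trans[OF \<rho> k(1)]
      by (intro divide_left_mono mult_pos_pos zero_less_power) auto
    then have "ennreal (norm (f y) / norm y ^ ?n) \<le> ennreal (1 / \<rho> k ^ ?n * norm (f y))"
      by (intro ennreal_leI) simp
    also have "\<dots> = T k y" using k \<rho>[of k] by (simp add: T_def flip: ennreal_mult)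
    also have "\<dots> = (\<Sum>k\<in>{k}. T k y)" by simp
    also have "\<dots> \<le> (\<Sum>k. T k y)" by (rule sum_le_suminf) auto
    finally show ?thesis using True by simp
  qed simp
  then have "(\<integral>\<^sup>+ y. ennreal (norm (indicat_real {y. norm x < norm y} y *\<^sub>R ((1 / norm y ^ ?n) *\<^sub>R f y))) \<partial>lebesgue)
      \<le> (\<integral>\<^sup>+ y. (\<Sum>k. T k y) \<partial>lebesgue)"
    by (intro nn_integral_mono) auto
  also have "\<dots> = (\<Sum>k. \<integral>\<^sup>+ y. T k y \<partial>lebesgue)" by (rule nn_integral_suminf) measurable
  also have "\<dots> = (\<Sum>k. ennreal (hardy_average f ((2::real) ^ k *\<^sub>R x)))"
  proof (rule suminf_cong)
    fix k
    have "(\<integral>\<^sup>+ y. T k y \<partial>lebesgue) = ennreal (1 / \<rho> k ^ ?n) * ball_mass (\<lambda>y. ennreal (norm (f y))) 0 (2 * \<rho> k)"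
      unfolding T_def ball_mass_def by (rule nn_integral_cmult) measurable
    also have "\<dots> = ennreal (1 / \<rho> k ^ ?n) * ennreal (LINT y:ball 0 (2 * \<rho> k)|lebesgue. norm (f y))"
      by (simp only: ball_mass_norm_eq_integral[OF int])
    also have "\<dots> = ennreal (1 / \<rho> k ^ ?n * (LINT y:ball 0 (2 * \<rho> k)|lebesgue. norm (f y)))"
      using \<rho>[of k] by (intro ennreal_mult'[symmetric]) simp
    also have "\<dots> = ennreal (hardy_average f ((2::real) ^ k *\<^sub>R x))"
      by (simp add: hardy_average_def \<rho>_def)
    finally show "(\<integral>\<^sup>+ y. T k y \<partial>lebesgue) = ennreal (hardy_average f ((2::real) ^ k *\<^sub>R x))" .
  qed
  finally show ?thesis .
qed

text \<open>Each single term of the weighted sum is at most \<open>\<tau>\<close>, so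
  \<open>a k\<close> is at most \<open>\<tau> powr (1 / p) * q ^ k\<close>. This crude pointwise
  bound replaces an infinite triangle inequality in the Morrey norm.\<close>

lemma suminf_le_weighted_powr:
  fixes a :: "nat \<Rightarrow> real" and q p \<tau> :: real
  assumes q: "0 < q" "q < 1" and p: "0 < p" and a: "\<And>k. 0 \<le> a k" and \<tau>: "0 \<le> \<tau>"
    and sum: "(\<Sum>k. ennreal ((1 / q powr p) ^ k) * ennreal (a k powr p)) \<le> ennreal \<tau>"
  shows "(\<Sum>k. ennreal (a k)) \<le> ennreal (\<tau> powr (1 / p) / (1 - q))"
proof -
  define W where "W k = ennreal ((1 / q powr p) ^ k) * ennreal (a k powr p)" for k
  have "a k \<le> \<tau> powr (1 / p) * q ^ k" for k
  proof -
    have "W k = (\<Sum>k\<in>{k}. W k)" by simp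
    also have "\<dots> \<le> (\<Sum>k. W k)" by (rule sum_le_suminf) auto
    finally have "ennreal ((1 / q powr p) ^ k * a k powr p) \<le> ennreal \<tau>"
      using sum q unfolding W_def by (simp add: ennreal_mult)
    then have "(1 / q powr p) ^ k * a k powr p \<le> \<tau>" using \<tau> by simp
    then have "a k powr p \<le> \<tau> * (q powr p) ^ k" using q by (simp add: field_simps power_divide)
    then have "(a k powr p) powr (1 / p) \<le> (\<tau> * (q powr p) ^ k) powr (1 / p)"
      using p by (intro powr_mono2) auto
    also have "\<dots> = \<tau> powr (1 / p) * ((q powr p) ^ k) powr (1 / p)" using q \<tau> by (simp add: powr_mult)
    also have "((q powr p) ^ k) powr (1 / p) = q ^ k"
      using q p by (simp add: powr_powr flip: powr_realpow)
    finally show ?thesis using a[of k] p by (simp add: powr_powr)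
  qed
  then have "(\<Sum>k. ennreal (a k)) \<le> (\<Sum>k. ennreal (\<tau> powr (1 / p) * q ^ k))"
    by (intro suminf_le ennreal_leI) auto
  also have "\<dots> = ennreal (\<tau> powr (1 / p) * (1 / (1 - q)))"
    using q by (intro suminf_ennreal_eq sums_mult geometric_sums) auto
  finally show ?thesis by simp
qed

text \<open>
  Splitting the dual Hardy integral into dyadic annuli bounds it by the dilates \<open>h (2 ^ k *\<^sub>R x)\<close> of
  \<open>h = hardy_average f\<close>. The weight \<open>q powr p\<close> is chosen so that the dilated masses still decay
  geometrically: \<open>2 powr lam / (q powr p * 2 ^ n) = 2 powr ((lam - n) / 2) < 1\<close>.
\<close>

lemma dual_hardy_op_bounded:
  fixes p lam :: real
  assumes p: "1 < p" and lam: "0 \<le> lam" "lam < real DIM('a::euclidean_space)"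
  shows "bounded_in_vanishing_morrey p lam
    (\<lambda>(f :: 'a \<Rightarrow> 'b::{banach, second_countable_topology}) x.
      set_integrable lebesgue {y. norm x < norm y} (\<lambda>y. (1 / norm y ^ DIM('a)) *\<^sub>R f y))
    dual_hardy_op"
proof -
  let ?n = "DIM('a)"
  define q where "q = 2 powr ((lam - ?n) / (2 * p))"
  have q0: "0 < q" by (simp add: q_def)
  have "2 powr ((lam - ?n) / (2 * p)) < (2::real) powr 0"
    using p lam by (intro powr_less_mono divide_neg_pos) auto
  then have q1: "q < 1" by (simp add: q_def)
  have qp: "q powr p = 2 powr ((lam - ?n) / 2)" using p by (simp add: q_def powr_powr)
  \<comment> \<open>The growing weight \<open>1 / q powr p\<close> of the \<open>k\<close>-th
    dilate, times the factor \<open>1 / 2 ^ n\<close> from the change of variables.\<close>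
  define b where "b = 1 / q powr p / 2 ^ ?n"
  have b0: "0 \<le> b" by (simp add: b_def)
  have "b * 2 powr lam = 2 powr (lam - ?n - (lam - ?n) / 2)"
    unfolding b_def qp powr_diff by (simp add: powr_realpow)
  also have "\<dots> < 2 powr 0" using lam by (intro powr_less_mono) auto
  finally have b1: "b * 2 powr lam < 1" by simp
  define A where "A = 1 / (1 - q)"
  have A0: "0 < A" using q1 by (simp add: A_def)
  define h where "h f y = ennreal (norm (hardy_average f y) powr p)" for f :: "'a \<Rightarrow> 'b" and y
  define T where "T f y = (\<Sum>k. ennreal ((1 / q powr p) ^ k) * h f ((2::real) ^ k *\<^sub>R y))" for f :: "'a \<Rightarrow> 'b" and y
  have key: "f \<in> borel_measurable lebesgue" "set_integrable lebesgue (ball x r) f"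
    "h f \<in> borel_measurable borel" "T f \<in> borel_measurable lebesgue"
    "ball_mass (T f) x r = (\<Sum>k. ennreal (b ^ k) * ball_mass (h f) ((2::real) ^ k *\<^sub>R x) (2 ^ k * r))"
    if f: "f \<in> vanishing_morrey_space p lam" for f x r
  proof -
    have fM: "f \<in> morrey_space p lam" using f by (simp add: vanishing_morrey_space_def)
    then show fm: "f \<in> borel_measurable lebesgue" using p by (simp add: morrey_space_iff)
    show "set_integrable lebesgue (ball x r) f" using p fM by (intro morrey_space_integrable_ball) auto
    have [measurable]: "hardy_average f \<in> borel_measurable borel" by (rule borel_measurable_hardy_average[OF fm])
    show h [measurable]: "h f \<in> borel_measurable borel" unfolding h_def[abs_def] by measurable
    have hk [measurable]: "(\<lambda>y. h f ((2::real) ^ k *\<^sub>R y)) \<in> borel_measurable lebesgue" for k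
      by (intro measurable_completion) measurable
    show T [measurable]: "T f \<in> borel_measurable lebesgue" unfolding T_def[abs_def] by measurable
    have "ball_mass (T f) x r = (\<integral>\<^sup>+ y. (\<Sum>k. ennreal ((1 / q powr p) ^ k) * (h f ((2::real) ^ k *\<^sub>R y) * indicator (ball x r) y)) \<partial>lebesgue)"
      unfolding ball_mass_def T_def by (simp only: ennreal_suminf_multc[symmetric] mult.assoc)
    also have "\<dots> = (\<Sum>k. ennreal ((1 / q powr p) ^ k) * ball_mass (\<lambda>y. h f ((2::real) ^ k *\<^sub>R y)) x r)"
      unfolding ball_mass_def by (subst nn_integral_suminf, measurable, subst nn_integral_cmult, measurable)
    also have "\<dots> = (\<Sum>k. ennreal (b ^ k) * ball_mass (h f) ((2::real) ^ k *\<^sub>R x) (2 ^ k * r))"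
    proof (rule suminf_cong)
      fix k
      have "(1 / q powr p) ^ k * (1 / (2 ^ k) ^ ?n) = b ^ k"
        by (simp add: b_def power_divide power_mult_distrib mult.commute flip: power_mult)
      then have "ennreal (b ^ k) = ennreal ((1 / q powr p) ^ k) * ennreal (1 / (2 ^ k) ^ ?n)"
        by (simp flip: ennreal_mult)
      then show "ennreal ((1 / q powr p) ^ k) * ball_mass (\<lambda>y. h f ((2::real) ^ k *\<^sub>R y)) x r
        = ennreal (b ^ k) * ball_mass (h f) ((2::real) ^ k *\<^sub>R x) (2 ^ k * r)"
        by (subst ball_mass_scaleR[OF h]) (simp_all add: mult.assoc)
    qed
    finally show "ball_mass (T f) x r = (\<Sum>k. ennreal (b ^ k) * ball_mass (h f) ((2::real) ^ k *\<^sub>R x) (2 ^ k * r))" .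
  qed
  \<comment> \<open>Finiteness of \<open>T f x\<close> gives both the convergence of the integral
    defining the operator at \<open>x\<close> and the size of its value.\<close>
  have pointwise: "set_integrable lebesgue {y. norm x < norm y} (\<lambda>y. (1 / norm y ^ ?n) *\<^sub>R f y)"
    "ennreal (norm (dual_hardy_op f x) powr p) \<le> ennreal (A powr p) * T f x"
    if f: "f \<in> vanishing_morrey_space p lam" and x: "x \<noteq> 0" and fin: "T f x < \<infinity>" for f and x :: 'a
  proof -
    note [measurable] = key(1)[OF f]
    obtain \<tau> where \<tau>: "0 \<le> \<tau>" "T f x = ennreal \<tau>" using fin by (cases "T f x") auto
    let ?g = "\<lambda>y. indicat_real {y. norm x < norm y} y *\<^sub>R ((1 / norm y ^ ?n) *\<^sub>R f y)"
    have "{y. norm x < norm y} \<in> sets (borel :: 'a measure)" by measurable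
    then have [measurable]: "{y. norm x < norm y} \<in> sets (lebesgue :: 'a measure)" by simp
    have [measurable]: "(\<lambda>y::'a. 1 / norm y ^ ?n) \<in> borel_measurable lebesgue"
      by (intro measurable_completion) measurable
    have gm: "?g \<in> borel_measurable lebesgue" by measurable
    have "(\<integral>\<^sup>+ y. ennreal (norm (?g y)) \<partial>lebesgue) \<le> (\<Sum>k. ennreal (hardy_average f ((2::real) ^ k *\<^sub>R x)))"
      using key(1,2)[OF f] x by (rule nn_integral_dual_hardy_le)
    also have "\<dots> \<le> ennreal (\<tau> powr (1 / p) / (1 - q))"
      using q0 q1 p \<tau> by (intro suminf_le_weighted_powr) (auto simp: hardy_average_nonneg T_def h_def)
    finally have le: "(\<integral>\<^sup>+ y. ennreal (norm (?g y)) \<partial>lebesgue) \<le> ennreal (A * \<tau> powr (1 / p))" by (simp add: A_def)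
    then have int: "integrable lebesgue ?g"
      using gm by (intro integrableI_bounded) (auto simp: less_top intro: order_le_less_trans)
    then show "set_integrable lebesgue {y. norm x < norm y} (\<lambda>y. (1 / norm y ^ ?n) *\<^sub>R f y)"
      unfolding set_integrable_def .
    have "ennreal (norm (dual_hardy_op f x)) \<le> ennreal (A * \<tau> powr (1 / p))"
      unfolding dual_hardy_op_def set_lebesgue_integral_def
      using integral_norm_bound_ennreal[OF int] le by (rule order_trans)
    then have "norm (dual_hardy_op f x) \<le> A * \<tau> powr (1 / p)" using A0 by simp
    then have "norm (dual_hardy_op f x) powr p \<le> (A * \<tau> powr (1 / p)) powr p"
      using p by (intro powr_mono2) auto
    also have "\<dots> = A powr p * \<tau>" using A0 p \<tau> by (simp add: powr_mult powr_powr)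
    finally show "ennreal (norm (dual_hardy_op f x) powr p) \<le> ennreal (A powr p) * T f x"
      using \<tau> by (simp add: ennreal_leI flip: ennreal_mult)
  qed
  \<comment> \<open>The dyadic annuli degenerate at the origin, so this null set is removed.\<close>
  have AE0: "AE x in lebesgue. (x::'a) \<noteq> 0" using AE_not_in[of "{0::'a}" lebesgue] by simp
  show ?thesis
  proof (rule bounded_in_vanishing_morrey_dominated[OF _ lam(1) _ b0 b1 _ hardy_average_bounded[OF p lam],
        where C="A powr p" and c="\<lambda>k. 2 ^ k"])
    fix f :: "'a \<Rightarrow> 'b" assume f: "f \<in> vanishing_morrey_space p lam"
    note [measurable] = key(1,4)[OF f]
    \<comment> \<open>The mass bound for the average yields one for \<open>T f\<close>, hence
      finiteness almost everywhere and the meaningfulness of the integral.\<close>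
    have "hardy_average f \<in> morrey_space p lam"
      using hardy_average_bounded[OF p lam, where 'b='b] f
      unfolding bounded_in_vanishing_morrey_def vanishing_morrey_space_def by blast
    then obtain K where K: "0 \<le> K" "mass_bound lam K (h f)"
      using p unfolding h_def[abs_def] by (auto simp: morrey_space_iff)
    have "mass_bound lam (1 / (1 - b * 2 powr lam) * K) (T f)"
      using key(5)[OF f] by (intro dominated_sum_mass_bound[OF _ b0 b1 K]) auto
    then have "AE x in lebesgue. T f x < \<infinity>" by (rule AE_finite_if_mass_bound[rotated]) measurable
    with AE0 show "AE x in (lebesgue :: 'a measure). set_integrable lebesgue {y. norm x < norm y} (\<lambda>y. (1 / norm y ^ ?n) *\<^sub>R f y)"
      by eventually_elim (rule pointwise(1)[OF f])
    have [measurable]: "(\<lambda>y::'a. 1 / norm y ^ ?n) \<in> borel_measurable lebesgue"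
      by (intro measurable_completion) measurable
    have "dual_hardy_op f \<in> borel_measurable borel"
      unfolding dual_hardy_op_def[abs_def] by (intro borel_measurable_integral_norm_less) measurable
    then show "dual_hardy_op f \<in> borel_measurable lebesgue" by (intro measurable_completion) simp
    fix x r
    \<comment> \<open>Where \<open>T f y\<close> is infinite, positivity of \<open>A\<close> makes
      the right-hand side infinite as well; so the bound holds at every \<open>y \<noteq> 0\<close>,
      convergent or not.\<close>
    have le: "ennreal (norm (dual_hardy_op f y) powr p) \<le> ennreal (A powr p) * T f y" if "y \<noteq> 0" for y
    proof (cases "T f y < \<infinity>")
      case True
      then show ?thesis using pointwise(2)[OF f that] by simp
    next
      case False
      then have "T f y = top" by (simp add: less_top[symmetric])
      then show ?thesis using A0 by (simp add: ennreal_mult_top)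
    qed
    have "ball_mass (\<lambda>y. ennreal (norm (dual_hardy_op f y) powr p)) x r
      \<le> (\<integral>\<^sup>+ y. ennreal (A powr p) * (T f y * indicator (ball x r) y) \<partial>lebesgue)"
      unfolding ball_mass_def mult.assoc[symmetric]
      using AE0 by (intro nn_integral_mono_AE) (auto elim!: eventually_mono intro!: mult_right_mono le)
    also have "\<dots> = ennreal (A powr p) * ball_mass (T f) x r"
      unfolding ball_mass_def by (rule nn_integral_cmult) measurable
    finally show "ball_mass (\<lambda>y. ennreal (norm (dual_hardy_op f y) powr p)) x r \<le> ennreal (A powr p)
      * (\<Sum>k. ennreal (b ^ k) * ball_mass (\<lambda>y. ennreal (norm (hardy_average f y) powr p)) ((2::real) ^ k *\<^sub>R x) (2 ^ k * r))"
      unfolding key(5)[OF f] h_def .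
  qed (use p in auto)
qed

theorem corollary3p9:
  fixes p lam :: real
  assumes "1 < p" and "0 \<le> lam" and "lam < real CARD('n::finite)"
  shows "(bounded_in_vanishing_morrey p lam
           (\<lambda>(f :: real ^ 'n \<Rightarrow> 'b::{real_normed_field, euclidean_space}) x. maximal_function f x < \<infinity>)
           (\<lambda>f x. enn2real (maximal_function f x)))
    \<and> (bounded_in_vanishing_morrey p lam
           (\<lambda>(f :: real ^ 'n \<Rightarrow> 'b) x. sharp_maximal_function f x < \<infinity>)
           (\<lambda>f x. enn2real (sharp_maximal_function f x)))
    \<and> (bounded_in_vanishing_morrey p lam
           (\<lambda>(f :: real ^ 'n \<Rightarrow> 'b) x. set_integrable lebesgue {y. norm y < norm x} f)
           hardy_op)
    \<and> (bounded_in_vanishing_morrey p lam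
           (\<lambda>(f :: real ^ 'n \<Rightarrow> 'b) x.
              set_integrable lebesgue {y. norm x < norm y} (\<lambda>y. (1 / norm y ^ CARD('n)) *\<^sub>R f y))
           dual_hardy_op)"
  using maximal_function_bounded[where 'a="real ^ 'n" and 'b='b, of p lam]
    sharp_maximal_function_bounded[where 'a="real ^ 'n" and 'b='b, of p lam]
    hardy_op_bounded[where 'a="real ^ 'n" and 'b='b, of p lam]
    dual_hardy_op_bounded[where 'a="real ^ 'n" and 'b='b, of p lam] assms
  by simp

end
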